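(* Let $n\ge 6$ and let $G$ be a connected subcubic bipartite graph on $n$ vertices. Then $\lambda_1(G)\le \lambda_1(B_n)$, with equality if and only if $G\cong B_n$.
   Context: All graphs are finite and simple. $\lambda_1(G)$ denotes the spectral radius of $G$, i.e. the largest eigenvalue of its adjacency matrix. A graph is irregular if its vertices do not all have the same degree. A connected subcubic bipartite graph on $n$ vertices means a connected irregular bipartite graph on $n$ vertices with maximum degree exactly $3$. A vertex of degree less than $3$ is called unsaturated. The graphs $B_n$, $n\ge 6$, are defined recursively (up to isomorphism): $B_6$ is obtained from $K_{3,3}$ by deleting an edge; for odd $n\ge 7$, $B_n$ is obtained from $B_{n-1}$ by adding a new vertex and joining it to one of the (two) unsaturated vertices of $B_{n-1}$; for even $n\ge 8$, $B_n$ is obtained from $B_{n-1}$ by adding a new vertex and joining it to all unsaturated vertices of $B_{n-1}$. *)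

theory Defs
  imports
    "Graph_Theory.Graph_Theory"
    "Jordan_Normal_Form.Spectral_Radius"
begin

(* Finite simple graphs are the symmetric loop-free digraphs of locale pair_graph, so an edge uv
   is the pair of arcs (u,v), (v,u), and the degree of a vertex is its out-degree. *)

abbreviation degree_of :: "'a pair_pre_digraph \<Rightarrow> 'a \<Rightarrow> nat" where
  "degree_of G v \<equiv> out_degree (with_proj G) v"

definition irregular :: "'a pair_pre_digraph \<Rightarrow> bool" where
  "irregular G \<longleftrightarrow> \<not> (\<exists>d. \<forall>v \<in> pverts G. degree_of G v = d)"

definition max_degree :: "'a pair_pre_digraph \<Rightarrow> nat" where
  "max_degree G = Max (degree_of G ` pverts G)"

definition bipartite :: "'a pair_pre_digraph \<Rightarrow> bool" where
  "bipartite G \<longleftrightarrow>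
    (\<exists>U V. pverts G = U \<union> V \<and> U \<inter> V = {} \<and> parcs G \<subseteq> U \<times> V \<union> V \<times> U)"

(* The constant Digraph_Component.connected is qualified because the topological notion of the
   same name is also in scope. *)
definition connected_subcubic_bipartite :: "'a pair_pre_digraph \<Rightarrow> bool" where
  "connected_subcubic_bipartite G \<longleftrightarrow>
    pair_graph G \<and> Digraph_Component.connected (with_proj G) \<and> irregular G \<and> bipartite G \<and>
    max_degree G = 3"

definition adjacency_matrix :: "'a list \<Rightarrow> 'a pair_pre_digraph \<Rightarrow> real mat" where
  "adjacency_matrix vs G =
    mat (length vs) (length vs) (\<lambda>(i, j). if (vs ! i, vs ! j) \<in> parcs G then 1 else 0)"

(* Different enumerations of the vertices give permutation-similar matrices, so the choice of vs
   does not affect the spectrum. The adjacency matrix is symmetric, hence all its complex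
   eigenvalues are real and the spectrum over the reals is all of it. *)
definition lambda1 :: "'a pair_pre_digraph \<Rightarrow> real" where
  "lambda1 G =
    Max (spectrum (adjacency_matrix (SOME vs. distinct vs \<and> set vs = pverts G) G))"

definition unsaturated :: "'a pair_pre_digraph \<Rightarrow> 'a set" where
  "unsaturated G = {v \<in> pverts G. degree_of G v < 3}"

definition join_vertex :: "'a \<Rightarrow> 'a set \<Rightarrow> 'a pair_pre_digraph \<Rightarrow> 'a pair_pre_digraph" where
  "join_vertex w S G =
    \<lparr> pverts = insert w (pverts G), parcs = parcs G \<union> {w} \<times> S \<union> S \<times> {w} \<rparr>"

definition K33 :: "nat pair_pre_digraph" where
  "K33 = \<lparr> pverts = {..<6}, parcs = {..<3} \<times> {3..<6} \<union> {3..<6} \<times> {..<3} \<rparr>"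

definition B6 :: "nat pair_pre_digraph" where
  "B6 = \<lparr> pverts = pverts K33, parcs = parcs K33 - {(0, 3), (3, 0)} \<rparr>"

(* The vertex set of B n is {..<n}, so n - 1 is the vertex new in step n. For odd n either of the
   two unsaturated vertices may be chosen, since some automorphism of B (n - 1) exchanges them; Min
   fixes one representative of the isomorphism class. Values for n < 6 are irrelevant. *)
fun B :: "nat \<Rightarrow> nat pair_pre_digraph" where
  "B n =
    (if n \<le> 6 then B6
     else if odd n then join_vertex (n - 1) {Min (unsaturated (B (n - 1)))} (B (n - 1))
     else join_vertex (n - 1) (unsaturated (B (n - 1))) (B (n - 1)))"

declare B.simps [simp del]

end

(*
  Let x be the Perron vector of G, with the vertices numbered 0, ..., n - 1 so that x decreases.
  Summation by parts writes the Rayleigh numerator of x as a combination, with nonnegative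
  coefficients g_k g_l formed from the gaps g_k = x_k - x_(k+1) (and x_n = 0), of the numbers
  e(k, l) of adjacent ordered pairs with one vertex among the first k and one among the first l.
  So it suffices to bound all e(k, l) by the corresponding numbers of B_n, suitably numbered.
  Counting half-edges modulo 3 in the two colour classes gives e(k, k) <= 3k - 2, hence
  e(k, k) <= 3k - 3 for odd k by parity, and e(k, k + 1) <= 3k - 1; beyond the first six vertices
  the ladder B_n attains all of these bounds.  On the first six vertices the numbering of the cap
  K_{3,3} - e has to be adapted to G.

  If the spectral radii agree, x is a Perron vector of the ladder too.  Its gaps between rungs are
  positive, so G and the ladder have the same e(k, l) for all l at the end of a rung; this
  determines G up to crossing the edges between consecutive rungs, hence up to isomorphism.
*)

theory Submission
  imports Defs "HOL-Analysis.Function_Topology"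
begin

section \<open>Maximisers of quadratic forms\<close>

text \<open>The two ends of a rung cannot be told apart analytically: for even \<open>n\<close> an
  automorphism of the ladder exchanges the two vertices of every rung, so the gaps of its Perron
  vector inside rungs vanish. Counts at the ends of rungs show that a vertex has one neighbour in an
  adjacent rung but not which one; the bipartition supplies the missing bit. Hence the description
  of adjacency by rungs and colours.

  The numbering of the cap must depend on G because small entries conflict. If 0 is adjacent to 1, 2
  and 3, then e(1, 4) = 3, but bipartiteness forces e(4, 4) = 6; a 4-cycle on the first four
  vertices has e(4, 4) = 8 but e(1, 4) = 2. If the first five vertices span K_{2,3}, the positions
  of its classes matter too: with classes {0, 1} and {2, 3, 4} one gets e(2, 5) = 6, while the other
  two caps have 5.\<close>

definition quad_form :: "'a set \<Rightarrow> ('a \<Rightarrow> 'a \<Rightarrow> real) \<Rightarrow> ('a \<Rightarrow> real) \<Rightarrow> real" where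
  "quad_form V a z = (\<Sum>u\<in>V. \<Sum>v\<in>V. a u v * z u * z v)"

text \<open>Perturb one coordinate \<open>u\<close> of a maximiser by \<open>t\<close>: the form
  minus \<open>m\<close> times the squared norm is quadratic in \<open>t\<close> with maximum 0 at
  \<open>t = 0\<close>, so its linear coefficient \<open>2 * d\<close> vanishes. This yields the
  Perron vector and, in the equality case, the eigenvalue equations on the ladder.\<close>

lemma quad_form_maximiser_eigenvector:
  assumes fin: "finite V"
    and sym: "\<And>u v. u \<in> V \<Longrightarrow> v \<in> V \<Longrightarrow> a u v = a v u"
    and max: "\<And>z. quad_form V a z \<le> m * (\<Sum>v\<in>V. (z v)\<^sup>2)"
    and att: "quad_form V a x = m * (\<Sum>v\<in>V. (x v)\<^sup>2)"
    and u: "u \<in> V"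
  shows "(\<Sum>v\<in>V. a u v * x v) = m * x u"
proof -
  define d where "d = (\<Sum>v\<in>V. a u v * x v) - m * x u"
  have ineq: "2 * t * d \<le> t\<^sup>2 * (m - a u u)" for t
  proof -
    define \<delta> where "\<delta> = (\<lambda>v. if v = u then 1 else 0 :: real)"
    define z where "z = (\<lambda>v. x v + t * \<delta> v)"
    have r: "(\<Sum>v\<in>V. g v * \<delta> v) = g u" for g
      using fin u by (simp add: \<delta>_def if_distrib cong: if_cong)
    have "quad_form V a z = (\<Sum>w\<in>V. \<Sum>v\<in>V. a w v * x w * x v) + t * (\<Sum>w\<in>V. (\<Sum>v\<in>V. (a w v * x w) * \<delta> v))
        + t * (\<Sum>w\<in>V. (\<Sum>v\<in>V. a w v * x v) * \<delta> w) + t\<^sup>2 * (\<Sum>w\<in>V. (\<Sum>v\<in>V. a w v * \<delta> v) * \<delta> w)"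
      unfolding quad_form_def z_def
      by (simp add: algebra_simps sum.distrib sum_distrib_left sum_distrib_right power2_eq_square)
    also have "(\<Sum>w\<in>V. (\<Sum>v\<in>V. (a w v * x w) * \<delta> v)) = (\<Sum>v\<in>V. a u v * x v)"
      unfolding r using sym u by (intro sum.cong) auto
    also have "(\<Sum>w\<in>V. (\<Sum>v\<in>V. a w v * x v) * \<delta> w) = (\<Sum>v\<in>V. a u v * x v)" by (rule r)
    also have "(\<Sum>w\<in>V. (\<Sum>v\<in>V. a w v * \<delta> v) * \<delta> w) = a u u" by (simp add: r)
    finally have 1: "quad_form V a z = quad_form V a x + 2 * t * (\<Sum>v\<in>V. a u v * x v) + t\<^sup>2 * a u u"
      by (simp add: quad_form_def)
    have "(\<Sum>v\<in>V. (z v)\<^sup>2) = (\<Sum>v\<in>V. (x v)\<^sup>2) + 2 * t * (\<Sum>v\<in>V. x v * \<delta> v) + t\<^sup>2 * (\<Sum>v\<in>V. \<delta> v * \<delta> v)"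
      unfolding z_def by (simp add: algebra_simps sum.distrib sum_distrib_left power2_eq_square)
    also have "\<dots> = (\<Sum>v\<in>V. (x v)\<^sup>2) + 2 * t * x u + t\<^sup>2"
      unfolding r by (simp add: \<delta>_def)
    finally have 2: "(\<Sum>v\<in>V. (z v)\<^sup>2) = (\<Sum>v\<in>V. (x v)\<^sup>2) + 2 * t * x u + t\<^sup>2" .
    show ?thesis using max[of z] unfolding 1 2 att d_def by (simp add: algebra_simps)
  qed
  \<comment> \<open>\<open>s\<close> is positive and exceeds \<open>m - a u u\<close>, so at
    \<open>t = d / s\<close> the linear term outweighs the quadratic one unless
    \<open>d = 0\<close>.\<close>
  define s where "s = \<bar>m - a u u\<bar> + 1"
  have "s > 0" unfolding s_def by simp
  have "2 * (d / s) * d \<le> (d / s)\<^sup>2 * (m - a u u)" by (rule ineq)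
  also have "\<dots> \<le> (d / s)\<^sup>2 * s" unfolding s_def by (intro mult_left_mono) auto
  also have "\<dots> = (d / s) * d" using \<open>s > 0\<close> by (simp add: power2_eq_square)
  finally have "d\<^sup>2 / s \<le> 0" by (simp add: power2_eq_square)
  hence "d = 0" using \<open>s > 0\<close> by (simp add: divide_le_0_iff)
  thus ?thesis unfolding d_def by simp
qed

text \<open>Maximise the form on the unit sphere; passing to absolute values does not lower it
  because \<open>a\<close> is nonnegative. Homogeneity extends the bound to all
  \<open>z\<close>.\<close>

lemma nonneg_symmetric_eigenvector:
  fixes a :: "'a \<Rightarrow> 'a \<Rightarrow> real"
  assumes fin: "finite V" and ne: "V \<noteq> {}"
    and sym: "\<And>u v. u \<in> V \<Longrightarrow> v \<in> V \<Longrightarrow> a u v = a v u"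
    and nonneg: "\<And>u v. u \<in> V \<Longrightarrow> v \<in> V \<Longrightarrow> 0 \<le> a u v"
  obtains m x where "\<And>v. 0 \<le> x v" "\<exists>v\<in>V. x v \<noteq> 0"
    "\<And>u. u \<in> V \<Longrightarrow> (\<Sum>v\<in>V. a u v * x v) = m * x u"
    "\<And>z. quad_form V a z \<le> m * (\<Sum>v\<in>V. (z v)\<^sup>2)"
proof -
  \<comment> \<open>The type \<open>'a\<close> may be infinite; pinning the coordinates outside
    \<open>V\<close> to 0 makes the box a product of compact sets, hence compact by
    Tychonoff.\<close>
  define box where "box = PiE UNIV (\<lambda>i::'a. if i \<in> V then {-1..1::real} else {0})"
  have "compactin (product_topology (\<lambda>_. euclidean) UNIV) box"
    unfolding box_def compactin_PiE by auto
  hence "compact box" by (simp add: euclidean_product_topology)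
  define K where "K = box \<inter> {z. (\<Sum>v\<in>V. (z v)\<^sup>2) = 1}"
  have contN: "continuous_on UNIV (\<lambda>z::'a\<Rightarrow>real. \<Sum>v\<in>V. (z v)\<^sup>2)"
    by (intro continuous_intros continuous_on_product_coordinates)
  have "closed {z::'a\<Rightarrow>real. (\<Sum>v\<in>V. (z v)\<^sup>2) = 1}"
    by (rule closed_Collect_eq[OF contN continuous_on_const])
  with \<open>compact box\<close> have "compact K" unfolding K_def by (rule compact_Int_closed)
  have inK: "z \<in> K" if "(\<Sum>v\<in>V. (z v)\<^sup>2) = 1" "\<And>v. v \<notin> V \<Longrightarrow> z v = 0" for z
  proof -
    have "\<bar>z v\<bar> \<le> 1" if "v \<in> V" for v
    proof -
      have "(z v)\<^sup>2 \<le> (\<Sum>v\<in>V. (z v)\<^sup>2)" by (rule member_le_sum) (use that fin in auto)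
      thus ?thesis using \<open>(\<Sum>v\<in>V. (z v)\<^sup>2) = 1\<close> by (simp add: abs_square_le_1)
    qed
    thus ?thesis using that unfolding K_def box_def by (auto simp: PiE_iff abs_le_iff)
  qed
  obtain v0 where v0: "v0 \<in> V" using ne by blast
  have "(\<lambda>v. if v = v0 then 1 else 0) \<in> K"
    by (rule inK) (use v0 fin in \<open>auto simp: if_distrib[of "\<lambda>t. t\<^sup>2"] cong: if_cong\<close>)
  hence "K \<noteq> {}" by blast
  have "continuous_on K (quad_form V a)"
    unfolding quad_form_def
    by (intro continuous_intros continuous_on_subset[OF continuous_on_product_coordinates subset_UNIV])
  from continuous_attains_sup[OF \<open>compact K\<close> \<open>K \<noteq> {}\<close> this]
  obtain x0 where x0: "x0 \<in> K" "\<And>z. z \<in> K \<Longrightarrow> quad_form V a z \<le> quad_form V a x0" by blast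
  define x where "x v = \<bar>x0 v\<bar>" for v
  define m where "m = quad_form V a x"
  have x1: "(\<Sum>v\<in>V. (x v)\<^sup>2) = 1" using x0(1) by (simp add: x_def K_def)
  have "quad_form V a x0 \<le> quad_form V a x"
    unfolding quad_form_def x_def
  proof (intro sum_mono)
    fix u v assume "u \<in> V" "v \<in> V"
    have "a u v * (x0 u * x0 v) \<le> a u v * (\<bar>x0 u\<bar> * \<bar>x0 v\<bar>)"
      by (rule mult_left_mono[OF _ nonneg]) (use \<open>u \<in> V\<close> \<open>v \<in> V\<close> in \<open>auto simp: abs_mult[symmetric]\<close>)
    thus "a u v * x0 u * x0 v \<le> a u v * \<bar>x0 u\<bar> * \<bar>x0 v\<bar>" by (simp add: mult.assoc)
  qed
  hence maxK: "quad_form V a z \<le> m" if "z \<in> K" for z using x0(2)[OF that] by (simp add: m_def)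
  have bound: "quad_form V a z \<le> m * (\<Sum>v\<in>V. (z v)\<^sup>2)" for z
  proof (cases "(\<Sum>v\<in>V. (z v)\<^sup>2) = 0")
    case True
    hence "\<forall>v\<in>V. z v = 0" using fin by (simp add: sum_nonneg_eq_0_iff)
    thus ?thesis using True by (simp add: quad_form_def)
  next
    case False
    define s where "s = sqrt (\<Sum>v\<in>V. (z v)\<^sup>2)"
    have s2: "s\<^sup>2 = (\<Sum>v\<in>V. (z v)\<^sup>2)" unfolding s_def by (simp add: sum_nonneg)
    have s0: "s > 0" unfolding s_def using False by (simp add: sum_nonneg less_le)
    define z' where "z' v = (if v \<in> V then z v / s else 0)" for v
    have "(\<Sum>v\<in>V. (z' v)\<^sup>2) = (\<Sum>v\<in>V. (z v)\<^sup>2) / s\<^sup>2"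
      unfolding sum_divide_distrib by (intro sum.cong) (auto simp: z'_def power_divide)
    also have "\<dots> = 1" unfolding s2[symmetric] using s0 by simp
    finally have "z' \<in> K" by (intro inK) (auto simp: z'_def)
    hence "quad_form V a z' \<le> m" by (rule maxK)
    moreover have "quad_form V a z' = quad_form V a z / s\<^sup>2"
      unfolding quad_form_def sum_divide_distrib
      by (intro sum.cong) (auto simp: z'_def power2_eq_square)
    ultimately have "quad_form V a z \<le> m * s\<^sup>2" using s0 by (simp add: divide_simps)
    thus ?thesis by (simp add: s2)
  qed
  have ev: "(\<Sum>v\<in>V. a u v * x v) = m * x u" if "u \<in> V" for u
    by (rule quad_form_maximiser_eigenvector[OF fin sym bound _ that]) (auto simp: m_def x1)
  have "\<exists>v\<in>V. x v \<noteq> 0" using x1 by (metis (mono_tags, lifting) sum.neutral zero_neq_one power_zero_numeral)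
  from that[OF _ this ev bound] show ?thesis by (simp add: x_def)
qed

section \<open>Edges between initial segments\<close>

definition nbrs :: "(nat \<Rightarrow> nat \<Rightarrow> bool) \<Rightarrow> nat \<Rightarrow> nat \<Rightarrow> nat" where
  "nbrs E i l = (\<Sum>j<l. of_bool (E i j))"

text \<open>The e(k, l) of the overview; an edge with both ends in both segments counts
  twice.\<close>

definition block_sum :: "(nat \<Rightarrow> nat \<Rightarrow> bool) \<Rightarrow> nat \<Rightarrow> nat \<Rightarrow> nat" where
  "block_sum E k l = (\<Sum>i<k. nbrs E i l)"

lemma nbrs_Suc [simp]: "nbrs E i (Suc l) = nbrs E i l + of_bool (E i l)"
  by (simp add: nbrs_def)

lemma nbrs_0 [simp]: "nbrs E i 0 = 0"
  by (simp add: nbrs_def)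

lemma nbrs_card: "nbrs E i l = card {j. j < l \<and> E i j}"
proof -
  have "{..<l} \<inter> {j. E i j} = {j. j < l \<and> E i j}" by auto
  thus ?thesis by (simp add: nbrs_def)
qed

lemma nbrs_mono: "l \<le> l' \<Longrightarrow> nbrs E i l \<le> nbrs E i l'"
  unfolding nbrs_def by (rule sum_mono2) auto

lemma block_sum_Suc_left [simp]: "block_sum E (Suc k) l = block_sum E k l + nbrs E k l"
  by (simp add: block_sum_def)

lemma block_sum_0 [simp]: "block_sum E 0 l = 0"
  by (simp add: block_sum_def)

lemma block_sum_mono: "l \<le> l' \<Longrightarrow> block_sum E k l \<le> block_sum E k l'"
  unfolding block_sum_def by (rule sum_mono) (rule nbrs_mono)

lemma block_sum_commute:
  assumes "\<And>i j. E i j \<longleftrightarrow> E j i"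
  shows "block_sum E k l = block_sum E l k"
proof -
  have "block_sum E k l = (\<Sum>j<l. \<Sum>i<k. of_bool (E i j))"
    unfolding block_sum_def nbrs_def by (rule sum.swap)
  also have "\<dots> = block_sum E l k"
    unfolding block_sum_def nbrs_def by (simp add: assms)
  finally show ?thesis .
qed

lemma block_sum_Suc_right:
  assumes "\<And>i j. E i j \<longleftrightarrow> E j i"
  shows "block_sum E k (Suc l) = block_sum E k l + nbrs E l k"
  using block_sum_commute[OF assms, where k = k] by simp

text \<open>\<open>cut\<close> is connectivity, stated for the cuts between an initial segment and
  the rest; \<open>deficient\<close> is irregularity in the presence of maximum degree 3;
  \<open>\<gamma>\<close> is the bipartition. \<open>E\<close> is a relation on all of
  \<open>nat\<close>, confined below \<open>n\<close> by \<open>bounded\<close> and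
  \<open>sym\<close>.\<close>

locale ordered_subcubic =
  fixes n :: nat and E :: "nat \<Rightarrow> nat \<Rightarrow> bool" and \<gamma> :: "nat \<Rightarrow> bool"
  assumes sym: "E i j \<Longrightarrow> E j i"
    and bip: "E i j \<Longrightarrow> \<gamma> i \<noteq> \<gamma> j"
    and bounded: "E i j \<Longrightarrow> j < n"
    and deg: "nbrs E i n \<le> 3"
    and cut: "0 < k \<Longrightarrow> k < n \<Longrightarrow> \<exists>i<k. \<exists>j\<ge>k. E i j"
    and deficient: "\<exists>i<n. nbrs E i n < 3"
begin

lemma sym_iff: "E i j \<longleftrightarrow> E j i"
  using sym by blast

lemma nbrs_le_3: "nbrs E i l \<le> 3"
proof -
  have "nbrs E i l \<le> nbrs E i n"
    unfolding nbrs_card using bounded by (intro card_mono) auto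
  thus ?thesis using deg[of i] by linarith
qed

lemma block_sum_le: "block_sum E k l \<le> 3 * k"
  unfolding block_sum_def using sum_bounded_above[of "{..<k}" "\<lambda>i. nbrs E i l" 3]
  by (simp add: nbrs_le_3 mult.commute)

lemma block_sum_lt:
  assumes "i < k" "nbrs E i l < 3"
  shows "block_sum E k l < 3 * k"
proof -
  have "block_sum E k l < (\<Sum>i<k. 3)"
    unfolding block_sum_def
    by (rule sum_strict_mono_ex1) (use assms nbrs_le_3 in auto)
  thus ?thesis by (simp add: mult.commute)
qed

text \<open>Counting the edges inside the first \<open>k\<close> vertices from either colour class shows that the numbers
  of half-edges missing from the two classes are congruent modulo 3, so they cannot be 0 and 1.\<close>

lemma block_sum_square_le:
  assumes "0 < k" "k \<le> n"
  shows "block_sum E k k + 2 \<le> 3 * k"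
proof -
  have ne: "block_sum E k k < 3 * k"
  proof (cases "k < n")
    case True
    then obtain i j where ij: "i < k" "j \<ge> k" "E i j" using cut assms by blast
    have "nbrs E i k < nbrs E i (Suc j)"
      using nbrs_mono[of k j E i] ij by simp
    hence "nbrs E i k < 3" using nbrs_le_3[of i "Suc j"] by linarith
    thus ?thesis using block_sum_lt ij(1) by blast
  next
    case False
    hence "k = n" using assms by simp
    thus ?thesis using deficient block_sum_lt by blast
  qed
  define P where "P = (\<Sum>i\<in>{i\<in>{..<k}. \<gamma> i}. nbrs E i k)"
  define N where "N = (\<Sum>i\<in>{i\<in>{..<k}. \<not> \<gamma> i}. nbrs E i k)"
  have tot: "block_sum E k k = P + N"
    unfolding P_def N_def block_sum_def
    by (subst sum.union_disjoint[symmetric]) (auto intro!: sum.cong)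
  have "P = (\<Sum>i<k. \<Sum>j<k. of_bool (\<gamma> i \<and> E i j))"
    unfolding P_def nbrs_def by (subst sum.inter_filter) (auto intro!: sum.cong)
  also have "\<dots> = (\<Sum>j<k. \<Sum>i<k. of_bool (\<gamma> i \<and> E i j))" by (rule sum.swap)
  also have "\<dots> = (\<Sum>j<k. \<Sum>i<k. of_bool (\<not> \<gamma> j \<and> E j i))"
    by (intro sum.cong refl) (use sym bip in auto)
  also have "\<dots> = N"
    unfolding N_def nbrs_def by (subst sum.inter_filter) (auto intro!: sum.cong)
  finally have PN: "P = N" .
  define a where "a = card {i\<in>{..<k}. \<gamma> i}"
  define b where "b = card {i\<in>{..<k}. \<not> \<gamma> i}"
  have "P \<le> 3 * a"
    unfolding P_def a_def using sum_bounded_above[of "{i\<in>{..<k}. \<gamma> i}" "\<lambda>i. nbrs E i k" 3] nbrs_le_3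
    by (simp add: mult.commute)
  moreover have "N \<le> 3 * b"
    unfolding N_def b_def using sum_bounded_above[of "{i\<in>{..<k}. \<not> \<gamma> i}" "\<lambda>i. nbrs E i k" 3] nbrs_le_3
    by (simp add: mult.commute)
  moreover have "a + b = k"
  proof -
    have "a + b = card ({i\<in>{..<k}. \<gamma> i} \<union> {i\<in>{..<k}. \<not> \<gamma> i})"
      unfolding a_def b_def by (subst card_Un_disjoint) auto
    also have "{i\<in>{..<k}. \<gamma> i} \<union> {i\<in>{..<k}. \<not> \<gamma> i} = {..<k}" by auto
    finally show ?thesis by simp
  qed
  ultimately show ?thesis using ne unfolding tot PN by presburger
qed

lemma even_block_sum: "even (block_sum E k k)"
proof (induction k)
  case (Suc k)
  have "\<not> E k k" using bip by blast
  thus ?case using Suc by (simp add: block_sum_Suc_right[OF sym_iff])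
qed simp

lemma block_sum_odd_le:
  assumes "odd k" "k \<le> n"
  shows "block_sum E k k + 3 \<le> 3 * k"
proof -
  have "block_sum E k k + 2 \<noteq> 3 * k"
    using even_block_sum[of k] assms by (metis even_add even_mult_iff even_numeral odd_numeral)
  moreover have "k > 0" using assms by (cases k) auto
  ultimately show ?thesis using block_sum_square_le[of k] assms by linarith
qed

text \<open>By symmetry e(k, k + 1) is the mean of e(k, k) and e(k + 1, k + 1), hence at most (6k -
  1) / 2, and it is an integer.\<close>

lemma block_sum_Suc_le:
  assumes "0 < k" "Suc k \<le> n"
  shows "block_sum E k (Suc k) + 1 \<le> 3 * k"
proof -
  have "\<not> E k k" using bip by blast
  hence "block_sum E (Suc k) (Suc k) = block_sum E k k + 2 * nbrs E k k"
    "block_sum E k (Suc k) = block_sum E k k + nbrs E k k"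
    by (simp_all add: block_sum_Suc_right[OF sym_iff])
  moreover have "block_sum E k k + 2 \<le> 3 * k" "block_sum E (Suc k) (Suc k) + 2 \<le> 3 * Suc k"
    using assms by (intro block_sum_square_le; simp)+
  ultimately show ?thesis by presburger
qed

end

section \<open>The infinite cubic ladder\<close>

text \<open>The six vertices below 6 form \<open>K\<^sub>3\<^sub>,\<^sub>3\<close> with colour classes given by \<open>c\<close> and the edge
  \<open>pq\<close> deleted; \<open>{6, 7}\<close>, \<open>{8, 9}\<close>, \<dots> are the rungs. The predicate \<open>down\<close> lists the neighbours
  \<open>j < i\<close> of \<open>i\<close>. Truncating the ladder to the vertices below \<open>n\<close> gives \<open>B n\<close> up to isomorphism.\<close>

definition down :: "(nat \<Rightarrow> bool) \<Rightarrow> nat \<Rightarrow> nat \<Rightarrow> nat \<Rightarrow> nat \<Rightarrow> bool" where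
  "down c p q i j \<longleftrightarrow> j < i \<and>
    (if i < 6 then c i \<noteq> c j \<and> {i, j} \<noteq> {p, q}
     else if i = 6 then j = p
     else if i = 7 then j = q \<or> j = 6
     else j = i - 2 \<or> odd i \<and> j = i - 1)"

definition ladder :: "(nat \<Rightarrow> bool) \<Rightarrow> nat \<Rightarrow> nat \<Rightarrow> nat \<Rightarrow> nat \<Rightarrow> bool" where
  "ladder c p q i j \<longleftrightarrow> down c p q i j \<or> down c p q j i"

lemma ladder_sym: "ladder c p q i j \<longleftrightarrow> ladder c p q j i"
  by (auto simp: ladder_def)

locale ladder_cap =
  fixes c :: "nat \<Rightarrow> bool" and p q :: nat
  assumes balanced: "card {i. i < 6 \<and> c i} = 3"
    and p: "p < 6" and q: "q < 6" and pq: "c p \<noteq> c q"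
begin

abbreviation "L \<equiv> ladder c p q"

lemma card_colour: "card {i. i < 6 \<and> c i = b} = 3"
proof (cases b)
  case False
  have "{i. i < 6 \<and> \<not> c i} = {..<6} - {i. i < 6 \<and> c i}" by auto
  hence "card {i. i < 6 \<and> \<not> c i} = card {..<6::nat} - card {i. i < 6 \<and> c i}"
    by (simp add: card_Diff_subset subset_eq)
  thus ?thesis using False balanced by simp
qed (use balanced in simp)

lemma top_iff: "i < 6 \<Longrightarrow> j < 6 \<Longrightarrow> L i j \<longleftrightarrow> c i \<noteq> c j \<and> {i, j} \<noteq> {p, q}"
  by (auto simp: ladder_def down_def doubleton_eq_iff) (metis linorder_neqE_nat)+

lemma nbrs_top:
  assumes "i < 6"
  shows "nbrs L i 6 + of_bool (i = p) + of_bool (i = q) = 3"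
proof -
  define M where "M = (if i = p then {q} else if i = q then {p} else {})"
  have "p \<noteq> q" using pq by blast
  hence M_iff: "j \<in> M \<longleftrightarrow> {i, j} = {p, q}" for j
    by (auto simp: M_def doubleton_eq_iff)
  have eq: "{j. j < 6 \<and> L i j} = {j. j < 6 \<and> c j = (\<not> c i)} - M"
    using top_iff[OF assms] M_iff by blast
  have M: "M \<subseteq> {j. j < 6 \<and> c j = (\<not> c i)}"
    unfolding M_def using p q pq by (cases "i = p"; cases "i = q") simp_all
  have "nbrs L i 6 = 3 - card M"
    unfolding nbrs_card eq by (subst card_Diff_subset) (use M in \<open>simp_all add: card_colour M_def\<close>)
  moreover have "card M = of_bool (i = p) + of_bool (i = q)" using \<open>p \<noteq> q\<close> by (simp add: M_def)
  ultimately show ?thesis using \<open>p \<noteq> q\<close> by (cases "i = p"; cases "i = q"; simp)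
qed

text \<open>Twice the eight edges of the cap; this equals \<open>3 * 6 - 2\<close>, the extremal
  value from which the induction along the rungs starts.\<close>

lemma block_sum_top: "block_sum L 6 6 = 16"
proof -
  have "block_sum L 6 6 + (\<Sum>i<6. of_bool (i = p)) + (\<Sum>i<6. of_bool (i = q))
      = (\<Sum>i<6. nbrs L i 6 + of_bool (i = p) + of_bool (i = q))"
    unfolding block_sum_def sum.distrib ..
  also have "\<dots> = (\<Sum>i<6::nat. 3)"
    by (rule sum.cong[OF refl], rule nbrs_top) simp
  finally have "block_sum L 6 6 + (\<Sum>i<6. of_bool (i = p)) + (\<Sum>i<6. of_bool (i = q)) = 18"
    by simp
  moreover have "(\<Sum>i<6. of_bool (i = r)) = (1::nat)" if "r < 6" for r :: nat
    using that unfolding of_bool_def by (subst sum.delta) auto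
  ultimately show ?thesis using p q by simp
qed

lemma ladder_down_iff: "j < k \<Longrightarrow> L k j \<longleftrightarrow> down c p q k j"
  by (auto simp: ladder_def down_def)

lemma nbrs_down:
  assumes "6 \<le> k"
  shows "nbrs L k k = (if even k then 1 else 2)"
proof -
  have "{j. j < k \<and> L k j} = (if k = 6 then {p} else if k = 7 then {q, 6} else if even k then {k - 2} else {k - 2, k - 1})"
    using assms p q by (auto simp: ladder_down_iff down_def)
  moreover have "even k \<Longrightarrow> k \<noteq> 7" "odd k \<Longrightarrow> k \<noteq> 6" by auto
  moreover have "card {k - 2, k - 1} = 2" using assms by (auto simp: card_insert_if)
  ultimately show ?thesis using q by (auto simp: nbrs_card)
qed

lemma nbrs_down_Suc:
  assumes "6 \<le> k"
  shows "nbrs L (Suc k) k = 1"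
proof -
  have "{j. j < k \<and> L (Suc k) j} = (if k = 6 then {q} else {k - 1})"
    using assms p q by (auto simp: ladder_def down_def)
  thus ?thesis by (simp add: nbrs_card)
qed

lemma not_ladder_diag: "\<not> L i i" by (simp add: ladder_def down_def)

lemma block_sum_square:
  assumes "6 \<le> k"
  shows "block_sum L k k + (if even k then 2 else 3) = 3 * k"
  using assms
proof (induction k rule: dec_induct)
  case base
  show ?case by (simp add: block_sum_top)
next
  case (step k)
  have "block_sum L (Suc k) (Suc k) = block_sum L k k + 2 * nbrs L k k"
    by (simp add: block_sum_Suc_right[OF ladder_sym] not_ladder_diag)
  thus ?case using step nbrs_down[of k] by (auto split: if_splits)
qed

lemma block_sum_Suc:
  assumes "6 \<le> k"
  shows "block_sum L k (Suc k) + 1 = 3 * k"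
  using block_sum_square[OF assms] nbrs_down[OF assms]
  by (auto simp: block_sum_Suc_right[OF ladder_sym] split: if_splits)

text \<open>The first \<open>k\<close> vertices have all their neighbours below
  \<open>k + 2\<close>, so the trivial bound is attained.\<close>

lemma block_sum_ge:
  assumes "6 \<le> k" "k + 2 \<le> l"
  shows "3 * k \<le> block_sum L k l"
proof -
  have "block_sum L k (Suc (Suc k)) = 3 * k"
    using block_sum_Suc[OF assms(1)] nbrs_down_Suc[OF assms(1)]
    by (subst block_sum_Suc_right[OF ladder_sym]) linarith
  thus ?thesis using block_sum_mono[of "k + 2" l L k] assms by simp
qed

end

section \<open>Domination by a ladder\<close>

lemma block_sum_mono_rel:
  assumes "\<And>i j. i < k \<Longrightarrow> j < l \<Longrightarrow> E i j \<Longrightarrow> F i j"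
  shows "block_sum E k l \<le> block_sum F k l"
  unfolding block_sum_def nbrs_def using assms by (intro sum_mono) auto

text \<open>With \<open>q\<close> in position 5, the only earlier vertex with a neighbour outside
  the cap is \<open>p\<close>, and that neighbour is 6. So every row before 5 is complete at column
  7.\<close>

lemma (in ladder_cap) block_sum_top_rows:
  assumes "q = 5" "p < 5" "k \<le> 5" "7 \<le> l"
  shows "3 * k \<le> block_sum L k l"
proof -
  have "3 \<le> nbrs L i l" if "i < k" for i
  proof -
    have "L i 6 \<longleftrightarrow> i = p" using that assms by (auto simp: ladder_def down_def)
    hence "nbrs L i (Suc 6) = 3" using nbrs_top[of i] that assms by (subst nbrs_Suc) auto
    hence "nbrs L i 7 = 3" by simp
    thus ?thesis using nbrs_mono[of 7 l L i] assms by simp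
  qed
  thus ?thesis unfolding block_sum_def
    using sum_bounded_below[of "{..<k}" 3 "\<lambda>i. nbrs L i l"] by (simp add: mult.commute)
qed

lemma nbrs_numeral:
  "nbrs E i (numeral m) = nbrs E i (pred_numeral m) + of_bool (E i (pred_numeral m))"
  by (simp add: numeral_eq_Suc)

lemma block_sum_numeral:
  "block_sum E (numeral m) l = block_sum E (pred_numeral m) l + nbrs E (pred_numeral m) l"
  by (simp add: numeral_eq_Suc)

lemma nbrs_one: "nbrs E i 1 = of_bool (E i 0)" and block_sum_one: "block_sum E 1 l = nbrs E 0 l"
  by simp_all

context ordered_subcubic begin

lemma irrefl: "\<not> E i i" using bip by blast

lemma sym_low:
  "E 1 0 \<longleftrightarrow> E 0 1" "E 2 0 \<longleftrightarrow> E 0 2" "E 3 0 \<longleftrightarrow> E 0 3" "E 4 0 \<longleftrightarrow> E 0 4" "E 5 0 \<longleftrightarrow> E 0 5"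
  "E 2 1 \<longleftrightarrow> E 1 2" "E 3 1 \<longleftrightarrow> E 1 3" "E 4 1 \<longleftrightarrow> E 1 4" "E 5 1 \<longleftrightarrow> E 1 5"
  "E 3 2 \<longleftrightarrow> E 2 3" "E 4 2 \<longleftrightarrow> E 2 4" "E 5 2 \<longleftrightarrow> E 2 5" "E 4 3 \<longleftrightarrow> E 3 4" "E 5 3 \<longleftrightarrow> E 3 5"
  "E 5 4 \<longleftrightarrow> E 4 5"
  using sym by blast+

text \<open>Up to symmetry, all other nonzero entries of the ladder already equal the general upper
  bounds; only the twenty entries in \<open>top\<close> depend on how the cap is numbered.\<close>

lemma block_sum_le_ladder:
  assumes cap: "ladder_cap c w 5" and w: "w < 5"
    and top: "\<And>k l. 1 \<le> k \<Longrightarrow> k \<le> 5 \<Longrightarrow> k \<le> l \<Longrightarrow> l \<le> 6 \<Longrightarrow>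
      block_sum E k l \<le> block_sum (ladder c w 5) k l"
    and kl: "k \<le> n" "l \<le> n"
  shows "block_sum E k l \<le> block_sum (ladder c w 5) k l"
proof -
  interpret ladder_cap c w 5 by (rule cap)
  have le: "block_sum E k l \<le> block_sum L k l" if kl: "k \<le> l" "l \<le> n" for k l
  proof -
    consider "k = 0" | "1 \<le> k" "k \<le> 5" "l \<le> 6" | "k \<le> 5" "7 \<le> l" | "6 \<le> k" "l = k"
      | "6 \<le> k" "l = Suc k" | "6 \<le> k" "k + 2 \<le> l" using kl by linarith
    thus ?thesis
    proof cases
      case 1 thus ?thesis by simp
    next
      case 2 thus ?thesis using top kl by blast
    next
      case 3 thus ?thesis using block_sum_top_rows[of k l] w block_sum_le[of k l] by linarith
    next
      case 4
      show ?thesis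
      proof (cases "even k")
        case True
        thus ?thesis using block_sum_square[of k] block_sum_square_le[of k] 4 kl by simp
      next
        case False
        thus ?thesis using block_sum_square[of k] block_sum_odd_le[of k] 4 kl by simp
      qed
    next
      case 5 thus ?thesis using block_sum_Suc[of k] block_sum_Suc_le[of k] kl by simp
    next
      case 6 thus ?thesis using block_sum_ge[of k l] block_sum_le[of k l] by linarith
    qed
  qed
  show ?thesis
  proof (cases "k \<le> l")
    case False
    thus ?thesis using le[of l k] kl
      by (simp add: block_sum_commute[OF sym_iff, where k = k] block_sum_commute[OF ladder_sym, where k = k])
  qed (use le kl in simp)
qed

text \<open>No single numbering of the cap dominates every \<open>G\<close>. Three suffice, according to whether the
  first five vertices of \<open>G\<close> span \<open>K\<^sub>2\<^sub>,\<^sub>3\<close>, the vertex 0 is adjacent to 1, 2 and 3, or neither.\<close>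

lemma block_sum_top_generic:
  assumes "6 \<le> n" "block_sum E 5 5 < 12" "\<not> (E 0 1 \<and> E 0 2 \<and> E 0 3)"
  shows "block_sum E 1 1 \<le> 0" "block_sum E 1 2 \<le> 1" "block_sum E 1 3 \<le> 2"
    "block_sum E 1 4 \<le> 2" "block_sum E 1 5 \<le> 3" "block_sum E 1 6 \<le> 3"
    "block_sum E 2 2 \<le> 2" "block_sum E 2 3 \<le> 3" "block_sum E 2 4 \<le> 4"
    "block_sum E 2 5 \<le> 5" "block_sum E 2 6 \<le> 6"
    "block_sum E 3 3 \<le> 4" "block_sum E 3 4 \<le> 6" "block_sum E 3 5 \<le> 7" "block_sum E 3 6 \<le> 9"
    "block_sum E 4 4 \<le> 8" "block_sum E 4 5 \<le> 10" "block_sum E 4 6 \<le> 12"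
    "block_sum E 5 5 \<le> 12" "block_sum E 5 6 \<le> 14"
proof -
  have a: "of_bool (E i j) \<le> (of_bool (\<gamma> i \<noteq> \<gamma> j) :: nat)" for i j using bip[of i j] by simp
  have cs: "of_bool (E 0 1) + of_bool (E 0 2) + of_bool (E 0 3) \<le> (2::nat)"
    using assms(3) by auto
  note exp = block_sum_numeral nbrs_numeral nbrs_one block_sum_one irrefl sym_low
  note top = a[of 0 1] a[of 0 2] a[of 0 3] a[of 0 4] a[of 1 2] a[of 1 3] a[of 1 4] a[of 2 3] a[of 2 4] a[of 3 4]
  have ev: "block_sum E 5 5 \<le> 10"
    using even_block_sum[of 5] assms(2) by (cases "block_sum E 5 5 = 11") auto
  show "block_sum E 1 6 \<le> 3" "block_sum E 2 6 \<le> 6" "block_sum E 3 6 \<le> 9" "block_sum E 4 6 \<le> 12"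
    "block_sum E 1 5 \<le> 3" "block_sum E 5 5 \<le> 12"
    using block_sum_le[of 1 6] block_sum_le[of 2 6] block_sum_le[of 3 6] block_sum_le[of 4 6]
      block_sum_le[of 1 5] assms(2) by simp_all
  show "block_sum E 5 6 \<le> 14" using block_sum_Suc_le[of 5] assms by simp
  show "block_sum E 1 1 \<le> 0" "block_sum E 1 2 \<le> 1" "block_sum E 1 3 \<le> 2"
    by (simp_all add: exp del: One_nat_def)
  show "block_sum E 1 4 \<le> 2" using cs by (simp add: exp del: One_nat_def)
  show "block_sum E 2 2 \<le> 2" by (simp add: exp del: One_nat_def)
  \<comment> \<open>\<open>top\<close> bounds each edge indicator by the difference of colours, so
    fixing the colours of 0, 1, 2, 3 leaves linear arithmetic.\<close>
  show "block_sum E 2 3 \<le> 3" "block_sum E 2 4 \<le> 4" "block_sum E 3 4 \<le> 6"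
    and 33: "block_sum E 3 3 \<le> 4" and 44: "block_sum E 4 4 \<le> 8"
    using top
    by (simp_all add: exp del: One_nat_def) (cases "\<gamma> 0"; cases "\<gamma> 1"; cases "\<gamma> 2"; cases "\<gamma> 3"; simp)+
  define b :: "nat \<Rightarrow> nat \<Rightarrow> nat" where "b i j = of_bool (E i j)" for i j
  have b: "of_bool (E i j) = b i j" for i j by (simp add: b_def)
  have tri: "b 0 1 + b 0 j + b 1 j \<le> 2" for j
    unfolding b_def using bip[of 0 1] bip[of 0 j] bip[of 1 j] by auto
  \<comment> \<open>By symmetry \<open>2 * block_sum E k 5\<close> is at most
    \<open>block_sum E k k + block_sum E 5 5\<close>, and the last term is at most 10 by
    parity.\<close>
  show "block_sum E 3 5 \<le> 7" "block_sum E 4 5 \<le> 10"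
    using ev 33 44 by (simp_all add: exp b del: One_nat_def)
  \<comment> \<open>Without the edge 01 the same averaging applies; with it, absence of triangles
    gives each of 2, 3, 4 at most one neighbour among 0 and 1.\<close>
  show "block_sum E 2 5 \<le> 5"
  proof (cases "b 0 1 = 0")
    case True
    thus ?thesis using ev by (simp add: exp b del: One_nat_def)
  next
    case False
    hence "b 0 1 = 1" by (simp add: b_def)
    thus ?thesis using tri[of 2] tri[of 3] tri[of 4] by (simp add: exp b del: One_nat_def)
  qed
qed

lemma block_sum_top_star:
  assumes "6 \<le> n" "E 0 1" "E 0 2" "E 0 3"
  shows "block_sum E 1 1 \<le> 0" "block_sum E 1 2 \<le> 1" "block_sum E 1 3 \<le> 2"
    "block_sum E 1 4 \<le> 3" "block_sum E 1 5 \<le> 3" "block_sum E 1 6 \<le> 3"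
    "block_sum E 2 2 \<le> 2" "block_sum E 2 3 \<le> 3" "block_sum E 2 4 \<le> 4"
    "block_sum E 2 5 \<le> 5" "block_sum E 2 6 \<le> 6"
    "block_sum E 3 3 \<le> 4" "block_sum E 3 4 \<le> 5" "block_sum E 3 5 \<le> 7" "block_sum E 3 6 \<le> 9"
    "block_sum E 4 4 \<le> 6" "block_sum E 4 5 \<le> 9" "block_sum E 4 6 \<le> 11"
    "block_sum E 5 5 \<le> 12" "block_sum E 5 6 \<le> 14"
proof -
  note exp = block_sum_numeral nbrs_numeral nbrs_one block_sum_one irrefl sym_low
  have ind: "\<not> E 1 2" "\<not> E 1 3" "\<not> E 2 3" using assms bip by blast+
  have e0: "\<not> E 0 4" "\<not> E 0 5"
    using nbrs_le_3[of 0 6] assms by (simp_all add: exp del: One_nat_def split: if_splits)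
  have a: "of_bool (E i j) \<le> (of_bool (\<gamma> i \<noteq> \<gamma> j) :: nat)" for i j using bip[of i j] by simp
  show "block_sum E 1 1 \<le> 0" "block_sum E 1 2 \<le> 1" "block_sum E 1 3 \<le> 2"
    "block_sum E 1 4 \<le> 3" "block_sum E 1 5 \<le> 3" "block_sum E 1 6 \<le> 3"
    "block_sum E 2 2 \<le> 2" "block_sum E 2 3 \<le> 3" "block_sum E 2 4 \<le> 4"
    "block_sum E 2 5 \<le> 5"
    "block_sum E 3 3 \<le> 4" "block_sum E 3 4 \<le> 5" "block_sum E 3 5 \<le> 7"
    "block_sum E 4 4 \<le> 6" "block_sum E 4 5 \<le> 9"
    using ind e0 by (simp_all add: exp del: One_nat_def)
  show "block_sum E 2 6 \<le> 6" "block_sum E 3 6 \<le> 9"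
    using block_sum_le[of 2 6] block_sum_le[of 3 6] by simp_all
  show "block_sum E 5 5 \<le> 12" "block_sum E 5 6 \<le> 14"
    using block_sum_Suc_le[of 5] block_sum_odd_le[of 5] assms(1) by simp_all
  \<comment> \<open>The first four vertices span only the star, which contributes 6;
    \<open>block_sum E 6 6 \<le> 16\<close> then leaves at most five edges from them to 4 and
    5.\<close>
  show "block_sum E 4 6 \<le> 11"
    using block_sum_square_le[of 6] assms ind e0 a[of 4 5] a[of 1 4] a[of 1 5] a[of 2 4] a[of 2 5] a[of 3 4] a[of 3 5]
    by (simp add: exp del: One_nat_def)
qed

lemma top_cases:
  fixes k l :: nat
  assumes "1 \<le> k" "k \<le> 5" "k \<le> l" "l \<le> 6"
    and "P 1 1" "P 1 2" "P 1 3" "P 1 4" "P 1 5" "P 1 6" "P 2 2" "P 2 3" "P 2 4" "P 2 5" "P 2 6"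
     "P 3 3" "P 3 4" "P 3 5" "P 3 6" "P 4 4" "P 4 5" "P 4 6" "P 5 5" "P 5 6"
  shows "P k l"
proof -
  have "k = 1 \<or> k = 2 \<or> k = 3 \<or> k = 4 \<or> k = 5" using assms(1,2) by linarith
  moreover have "l = 1 \<or> l = 2 \<or> l = 3 \<or> l = 4 \<or> l = 5 \<or> l = 6" using assms(1,3,4) by linarith
  ultimately show ?thesis using assms by (elim disjE) (simp_all del: One_nat_def)
qed

text \<open>The cap copies the star at 0. The constants in \<open>block_sum_top_star\<close> are
  exactly the values of this cap, so the comparison is plain evaluation.\<close>

lemma dominated_star:
  assumes "6 \<le> n" "E 0 1" "E 0 2" "E 0 3"
  defines "c \<equiv> \<lambda>i::nat. i \<in> {1, 2, 3}"
  shows "ladder_cap c 3 5"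
    and "k \<le> n \<Longrightarrow> l \<le> n \<Longrightarrow> block_sum E k l \<le> block_sum (ladder c 3 5) k l"
proof -
  have "{i::nat. i < 6 \<and> c i} = {1, 2, 3}" by (auto simp: c_def)
  thus cap: "ladder_cap c 3 5" by unfold_locales (auto simp: c_def)
  note exp = block_sum_numeral nbrs_numeral nbrs_one block_sum_one ladder_def down_def c_def
  have tab: "block_sum E k l \<le> block_sum (ladder c 3 5) k l" if "1 \<le> k" "k \<le> 5" "k \<le> l" "l \<le> 6" for k l
    by (rule top_cases[OF that]; rule order.trans, rule block_sum_top_star[OF assms(1-4)],
        simp add: exp doubleton_eq_iff del: One_nat_def)
  show "block_sum E k l \<le> block_sum (ladder c 3 5) k l" if "k \<le> n" "l \<le> n"
    by (rule block_sum_le_ladder[OF cap _ tab that]) simp_all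
qed

text \<open>This cap begins with the 4-cycle 0, 1, 3, 2, and the constants in
  \<open>block_sum_top_generic\<close> are again its exact values.\<close>

lemma dominated_generic:
  assumes "6 \<le> n" "block_sum E 5 5 < 12" "\<not> (E 0 1 \<and> E 0 2 \<and> E 0 3)"
  defines "c \<equiv> \<lambda>i::nat. i \<in> {1, 2, 4}"
  shows "ladder_cap c 4 5"
    and "k \<le> n \<Longrightarrow> l \<le> n \<Longrightarrow> block_sum E k l \<le> block_sum (ladder c 4 5) k l"
proof -
  have "{i::nat. i < 6 \<and> c i} = {1, 2, 4}" by (auto simp: c_def)
  thus cap: "ladder_cap c 4 5" by unfold_locales (auto simp: c_def)
  note exp = block_sum_numeral nbrs_numeral nbrs_one block_sum_one ladder_def down_def c_def
  have tab: "block_sum E k l \<le> block_sum (ladder c 4 5) k l" if "1 \<le> k" "k \<le> 5" "k \<le> l" "l \<le> 6" for k l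
    by (rule top_cases[OF that]; rule order.trans, rule block_sum_top_generic[OF assms(1-3)],
        simp add: exp doubleton_eq_iff del: One_nat_def)
  show "block_sum E k l \<le> block_sum (ladder c 4 5) k l" if "k \<le> n" "l \<le> n"
    by (rule block_sum_le_ladder[OF cap _ tab that]) simp_all
qed

text \<open>Here the cap inherits the colours of G, so that the first six vertices of G span a
  subgraph of it and the table follows by monotonicity. Vertex 5 completes the class of two;
  \<open>w\<close> is a vertex of the class of three not adjacent to 5, which exists because
  \<open>block_sum E 6 6 \<le> 16\<close> allows 5 at most two neighbours there.\<close>

lemma dominated_K23:
  assumes n: "6 \<le> n" and K23: "12 \<le> block_sum E 5 5"
  obtains c w where "ladder_cap c w 5" "w < 5"
    "\<And>k l. k \<le> n \<Longrightarrow> l \<le> n \<Longrightarrow> block_sum E k l \<le> block_sum (ladder c w 5) k l"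
proof -
  define Y where "Y b = {i. i < 5 \<and> \<gamma> i = b}" for b
  have "card (Y True \<union> Y False) = card (Y True) + card (Y False)"
    by (rule card_Un_disjoint) (auto simp: Y_def)
  moreover have "Y True \<union> Y False = {..<5}" by (auto simp: Y_def)
  ultimately have tot: "card (Y True) + card (Y False) = 5" by simp
  have row: "nbrs E i 5 \<le> card (Y (\<not> \<gamma> i))" for i
    unfolding nbrs_card using bip by (intro card_mono) (auto simp: Y_def)
  have sq: "block_sum F 5 5 = (\<Sum>i\<in>Y True. nbrs F i 5) + (\<Sum>i\<in>Y False. nbrs F i 5)" for F
    unfolding block_sum_def
    by (subst sum.union_disjoint[symmetric]) (auto simp: Y_def intro!: sum.cong)
  have up: "(\<Sum>i\<in>Y b. nbrs E i 5) \<le> card (Y b) * card (Y (\<not> b))" for b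
    using sum_bounded_above[of "Y b" "\<lambda>i. nbrs E i 5" "card (Y (\<not> b))"] row by (auto simp: Y_def)
  \<comment> \<open>e(5, 5) is at most twice the product of the class sizes, and among splittings of
    5 only 2 + 3 has product at least 6.\<close>
  have prod: "12 \<le> 2 * (card (Y True) * card (Y False))"
    using K23 sq[of E] up[of True] up[of False] by (simp add: mult.commute)
  have "card (Y True) \<in> {0,1,2,3,4,5}" using tot by auto
  hence "card (Y True) = 2 \<and> card (Y False) = 3 \<or> card (Y True) = 3 \<and> card (Y False) = 2"
    using tot prod by auto
  then obtain b where b: "card (Y b) = 2" "card (Y (\<not> b)) = 3"
    by (metis (full_types))
  have full: "nbrs E i 5 = card (Y (\<not> \<gamma> i))" if "i < 5" for i
  proof (rule ccontr)
    assume "nbrs E i 5 \<noteq> card (Y (\<not> \<gamma> i))"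
    hence lt: "nbrs E i 5 < card (Y (\<not> \<gamma> i))" using row[of i] by simp
    have "nbrs E j 5 \<le> card (Y (\<not> \<gamma> i))" if "j \<in> Y (\<gamma> i)" for j
    proof -
      have "\<gamma> j = \<gamma> i" using that by (simp add: Y_def)
      thus ?thesis using row[of j] by simp
    qed
    hence "(\<Sum>j\<in>Y (\<gamma> i). nbrs E j 5) < (\<Sum>j\<in>Y (\<gamma> i). card (Y (\<not> \<gamma> i)))"
      by (intro sum_strict_mono_ex1 ballI bexI[of _ i]) (use lt that in \<open>auto simp: Y_def\<close>)
    moreover have "card (Y (\<gamma> i)) * card (Y (\<not> \<gamma> i)) = 6"
      using b by (cases b; cases "\<gamma> i") simp_all
    ultimately show False using K23 sq[of E] up[of "\<not> \<gamma> i"] by (cases "\<gamma> i") (simp_all add: mult.commute)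
  qed
  have "nbrs E 5 5 \<le> 2"
  proof -
    have "block_sum E 6 6 = block_sum E 5 5 + 2 * nbrs E 5 5"
      using block_sum_Suc_left[of E 5 6] nbrs_Suc[of E 5 5] irrefl[of 5]
        block_sum_Suc_right[OF sym_iff, where k = 5 and l = 5] by simp
    thus ?thesis using block_sum_square_le[of 6] n K23 by simp
  qed
  hence "\<not> Y (\<not> b) \<subseteq> {j. j < 5 \<and> E 5 j}"
    using card_mono[of "{j. j < 5 \<and> E 5 j}" "Y (\<not> b)"] b(2) by (auto simp: nbrs_card)
  then obtain w where w: "w < 5" "\<gamma> w \<noteq> b" "\<not> E 5 w" by (auto simp: Y_def)
  \<comment> \<open>Vertex 5 may have no neighbour among the first five, in which case
    \<open>\<gamma> 5\<close> is unrelated to \<open>b\<close>; the cap recolours it.\<close>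
  define c where "c = \<gamma>(5 := b)"
  have c5: "{i. i < 6 \<and> c i = (\<not> b)} = Y (\<not> b)" by (auto simp: c_def Y_def less_Suc_eq numeral_eq_Suc)
  have "{i. i < 6 \<and> c i = b} = {..<6} - Y (\<not> b)" unfolding c5[symmetric] by blast
  hence "card {i. i < 6 \<and> c i = b} = card {..<6::nat} - card (Y (\<not> b))"
    by (simp add: card_Diff_subset Y_def subset_eq)
  hence c3: "card {i. i < 6 \<and> c i = b} = 3" using b(2) by simp
  have "card {i. i < 6 \<and> c i} = 3"
  proof (cases b)
    case True
    thus ?thesis using c3 by simp
  next
    case False
    thus ?thesis using c5 b(2) by simp
  qed
  hence cap: "ladder_cap c w 5" using w by unfold_locales (auto simp: c_def)
  interpret ladder_cap c w 5 by (rule cap)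
  have sub5: "E 5 j \<Longrightarrow> j < 5 \<Longrightarrow> \<gamma> j \<noteq> b" for j
  proof
    assume j: "E 5 j" "j < 5" "\<gamma> j = b"
    have "nbrs E j (Suc 5) = nbrs E j 5 + of_bool (E j 5)" by (rule nbrs_Suc)
    moreover have "E j 5" using j sym by blast
    ultimately show False using full[of j] j b nbrs_le_3[of j 6] by simp
  qed
  have "ladder c w 5 i j" if ij: "E i j" "i < 6" "j < 6" for i j
  proof -
    have "i \<noteq> j" using ij irrefl by blast
    consider "i < 5" "j < 5" | "i = 5" "j < 5" | "i < 5" "j = 5" using ij \<open>i \<noteq> j\<close> by linarith
    thus ?thesis
    proof cases
      case 1 thus ?thesis using top_iff[OF ij(2,3)] bip[OF ij(1)] by (auto simp: c_def doubleton_eq_iff)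
    next
      case 2 thus ?thesis using top_iff[OF ij(2,3)] sub5[of j] w ij by (auto simp: c_def doubleton_eq_iff)
    next
      case 3 thus ?thesis using top_iff[OF ij(2,3)] sub5[of i] w sym[OF ij(1)] by (auto simp: c_def doubleton_eq_iff)
    qed
  qed
  hence "block_sum E k l \<le> block_sum (ladder c w 5) k l" if "k \<le> 5" "l \<le> 6" for k l
    using that by (intro block_sum_mono_rel) auto
  from that[OF cap w(1) block_sum_le_ladder[OF cap w(1)]] this show ?thesis by blast
qed

lemma ex_dominating_cap:
  assumes n: "6 \<le> n"
  obtains c w where "ladder_cap c w 5" "w < 5"
    "\<And>k l. k \<le> n \<Longrightarrow> l \<le> n \<Longrightarrow> block_sum E k l \<le> block_sum (ladder c w 5) k l"
proof (cases "12 \<le> block_sum E 5 5")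
  case True
  thus ?thesis using dominated_K23[OF n] that by blast
next
  case False
  show ?thesis
  proof (cases "E 0 1 \<and> E 0 2 \<and> E 0 3")
    case True
    thus ?thesis using that[OF dominated_star(1) _ dominated_star(2)] n by auto
  next
    case star: False
    show ?thesis using that[OF dominated_generic(1) _ dominated_generic(2)] n False star by auto
  qed
qed

end

section \<open>Ladders described by rungs and colours\<close>

lemma bij_betw_respecting_fibres:
  assumes fin: "finite A" "finite C"
    and card: "\<And>y. card {a \<in> A. \<phi> a = y} = card {b \<in> C. \<psi> b = y}"
  obtains h where "bij_betw h A C" "\<And>a. a \<in> A \<Longrightarrow> \<psi> (h a) = \<phi> a"
proof -
  have "\<exists>h. bij_betw h {a \<in> A. \<phi> a = y} {b \<in> C. \<psi> b = y}" for y
    using fin card by (intro finite_same_card_bij) auto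
  then obtain H where H: "\<And>y. bij_betw (H y) {a \<in> A. \<phi> a = y} {b \<in> C. \<psi> b = y}" by metis
  define h where "h a = H (\<phi> a) a" for a
  have h: "h a \<in> C" "\<psi> (h a) = \<phi> a" if "a \<in> A" for a
    using bij_betwE[OF H[of "\<phi> a"]] that by (auto simp: h_def)
  have "inj_on h A"
  proof (rule inj_onI)
    fix a a' assume a: "a \<in> A" "a' \<in> A" "h a = h a'"
    hence "\<phi> a = \<phi> a'" using h(2) by metis
    thus "a = a'" using a bij_betw_imp_inj_on[OF H[of "\<phi> a"]] by (auto simp: h_def dest: inj_onD)
  qed
  moreover have "h ` A = C"
  proof
    show "C \<subseteq> h ` A"
    proof
      fix b assume "b \<in> C"
      hence "b \<in> H (\<psi> b) ` {a \<in> A. \<phi> a = \<psi> b}" using bij_betw_imp_surj_on[OF H[of "\<psi> b"]] by simp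
      then obtain a where "b = H (\<psi> b) a" "a \<in> A" "\<phi> a = \<psi> b" by blast
      hence "b = h a" by (simp add: h_def)
      thus "b \<in> h ` A" using \<open>a \<in> A\<close> by blast
    qed
  qed (use h in auto)
  ultimately show ?thesis using that h(2) by (auto simp: bij_betw_def)
qed

text \<open>The four saturated cap vertices form rung 0, the deleted edge \<open>pq\<close> rung 1. Adjacency then depends
  only on rungs and colours; rung 1 is the only rung whose two vertices are not adjacent.\<close>

definition rung :: "nat \<Rightarrow> nat \<Rightarrow> nat \<Rightarrow> nat" where
  "rung p q i = (if i = p \<or> i = q then 1 else if i < 6 then 0 else i div 2 - 1)"

definition rung_adj :: "nat \<Rightarrow> nat \<Rightarrow> bool" where
  "rung_adj a b \<longleftrightarrow> a = Suc b \<or> b = Suc a \<or> a = b \<and> a \<noteq> 1"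

text \<open>The proper 2-colouring extending \<open>c\<close>: a step by 2 along a rail and a step
  from an even \<open>i\<close> to \<open>i + 1\<close> across a rung both switch membership of the
  residue modulo 4 in {0, 3}. Vertex 6, adjacent to \<open>p\<close>, starts with the colour
  opposite to \<open>c p\<close>.\<close>

definition ladder_colour :: "(nat \<Rightarrow> bool) \<Rightarrow> nat \<Rightarrow> nat \<Rightarrow> bool" where
  "ladder_colour c p i = (if i < 6 then c i else c p = (i mod 4 \<in> {0, 3}))"

lemma rung_adj_commute: "rung_adj a b \<longleftrightarrow> rung_adj b a"
  by (auto simp: rung_adj_def)

lemma ladder_complement: "ladder (\<lambda>i. \<not> c i) p q = ladder c p q"
  by (intro ext) (simp add: ladder_def down_def)

text \<open>Writing the indices as \<open>4 * a + u\<close> and \<open>4 * b + v\<close> turns the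
  sixteen residue pairs into linear arithmetic.\<close>

lemma ladder_step_arith_aux:
  fixes a b u v :: nat
  assumes "u = 0 \<or> u = 1 \<or> u = 2 \<or> u = 3" "v = 0 \<or> v = 1 \<or> v = 2 \<or> v = 3" "4 * b + v < 4 * a + u"
  shows "(2 * a + u div 2 = 2 * b + v div 2 + 1 \<or> 2 * a + u div 2 = 2 * b + v div 2) \<and>
    ((u = 0 \<or> u = 3) \<noteq> (v = 0 \<or> v = 3)) \<longleftrightarrow> 4 * b + v + 2 = 4 * a + u \<or> odd u \<and> 4 * b + v + 1 = 4 * a + u"
  using assms(3,1,2) by (elim disjE; hypsubst; simp; arith)

lemma ladder_step_arith:
  fixes i j :: nat
  assumes "j < i"
  shows "(i div 2 = j div 2 + 1 \<or> i div 2 = j div 2) \<and>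
    ((i mod 4 = 0 \<or> i mod 4 = 3) \<noteq> (j mod 4 = 0 \<or> j mod 4 = 3)) \<longleftrightarrow> j + 2 = i \<or> odd i \<and> j + 1 = i"
proof -
  have div2: "(4 * x + y) div 2 = 2 * x + y div 2" for x y :: nat by presburger
  have mod4: "x mod 4 = 0 \<or> x mod 4 = 1 \<or> x mod 4 = 2 \<or> x mod 4 = 3" for x :: nat by presburger
  define a b u v where "a = i div 4" and "b = j div 4" and "u = i mod 4" and "v = j mod 4"
  have i: "i = 4 * a + u" and j: "j = 4 * b + v" by (simp_all add: a_def b_def u_def v_def)
  have odd: "odd i \<longleftrightarrow> odd u" by (simp add: i)
  have div: "i div 2 = 2 * a + u div 2" "j div 2 = 2 * b + v div 2" unfolding i j by (rule div2)+
  show ?thesis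
    unfolding div odd u_def[symmetric] v_def[symmetric]
    by (rule ladder_step_arith_aux[of u v b a, folded i j]) (use assms mod4 in \<open>simp_all only: u_def v_def\<close>)
qed

context ladder_cap begin

lemma swap: "ladder_cap c q p"
  using balanced p q pq by unfold_locales auto

lemma complement: "ladder_cap (\<lambda>i. \<not> c i) p q"
  using card_colour[of False] p q pq by unfold_locales auto

lemma rung_ge_2: "6 \<le> i \<Longrightarrow> rung p q i = i div 2 - 1" "6 \<le> i \<Longrightarrow> 2 \<le> rung p q i"
  using p q by (auto simp: rung_def)

lemma rung_le_1: "i < 6 \<Longrightarrow> rung p q i \<le> 1"
  by (simp add: rung_def)

lemma ladder_code_down:
  assumes "j < i"
  shows "L i j \<longleftrightarrow> rung_adj (rung p q i) (rung p q j) \<and> ladder_colour c p i \<noteq> ladder_colour c p j"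
proof -
  consider "i < 6" | "i = 6" "j < 6" | "i = 7" "j < 6" | "8 \<le> i" "j < 6" | "6 \<le> j" using assms by linarith
  thus ?thesis
  proof cases
    case 1
    thus ?thesis using assms pq
      by (auto simp: top_iff rung_def rung_adj_def ladder_colour_def doubleton_eq_iff)
  next
    case 2
    have "L i j \<longleftrightarrow> j = p" using 2 by (simp add: ladder_down_iff down_def)
    moreover have "rung p q i = 2" using 2 rung_ge_2[of i] by simp
    hence "rung_adj (rung p q i) (rung p q j) \<longleftrightarrow> j = p \<or> j = q"
      using 2 by (simp add: rung_adj_def rung_def)
    moreover have "ladder_colour c p i = (\<not> c p)" "ladder_colour c p j = c j" using 2 by (simp_all add: ladder_colour_def)
    ultimately show ?thesis using pq by auto
  next
    case 3
    have "L i j \<longleftrightarrow> j = q" using 3 by (simp add: ladder_down_iff down_def)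
    moreover have "rung p q i = 2" using 3 rung_ge_2[of i] by simp
    hence "rung_adj (rung p q i) (rung p q j) \<longleftrightarrow> j = p \<or> j = q"
      using 3 by (simp add: rung_adj_def rung_def)
    moreover have "ladder_colour c p i = c p" "ladder_colour c p j = c j" using 3 by (simp_all add: ladder_colour_def)
    ultimately show ?thesis using pq by auto
  next
    case 4
    have "\<not> L i j" using 4 by (auto simp: ladder_down_iff down_def)
    moreover have "3 \<le> rung p q i" "rung p q j \<le> 1" using 4 rung_ge_2[of i] rung_le_1[of j] by auto
    ultimately show ?thesis by (auto simp: rung_adj_def)
  next
    case 5
    have "L i j \<longleftrightarrow> j + 2 = i \<or> odd i \<and> j + 1 = i"
      using 5 assms p q by (auto simp: ladder_down_iff down_def)
    moreover have "rung_adj (rung p q i) (rung p q j) \<longleftrightarrow> i div 2 = j div 2 + 1 \<or> i div 2 = j div 2"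
    proof -
      have "3 \<le> i div 2" "3 \<le> j div 2" "j div 2 \<le> i div 2" using 5 assms by auto
      moreover have "rung_adj (u - 1) (v - 1) \<longleftrightarrow> u = v + 1 \<or> u = v" if "3 \<le> u" "3 \<le> v" "v \<le> u" for u v
        using that by (cases u; cases v) (auto simp: rung_adj_def)
      ultimately show ?thesis using 5 assms by (simp add: rung_ge_2)
    qed
    moreover have "(ladder_colour c p i \<noteq> ladder_colour c p j) \<longleftrightarrow>
        ((i mod 4 = 0 \<or> i mod 4 = 3) \<noteq> (j mod 4 = 0 \<or> j mod 4 = 3))"
      using 5 assms by (auto simp: ladder_colour_def)
    ultimately show ?thesis using ladder_step_arith[OF assms] by simp
  qed
qed

lemma ladder_code:
  "L i j \<longleftrightarrow> rung_adj (rung p q i) (rung p q j) \<and> ladder_colour c p i \<noteq> ladder_colour c p j"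
proof (cases i j rule: linorder_cases)
  case less
  thus ?thesis using ladder_code_down[of i j] ladder_sym[of c p q i j] rung_adj_commute by metis
next
  case equal thus ?thesis by (simp add: not_ladder_diag)
next
  case greater thus ?thesis by (rule ladder_code_down)
qed

text \<open>The class sizes depend on the cap only through \<open>c p\<close> and
  \<open>c q\<close>. Two caps that agree there can therefore be matched with colours and the marked
  vertices preserved.\<close>

lemma card_class:
  "card {i \<in> {..<6}. (c i, i = p, i = q) = y} =
    (case y of (b, P, Q) \<Rightarrow> if P \<and> Q then 0 else if P then of_bool (b = c p) else if Q then of_bool (b = c q) else 2)"
proof -
  obtain b P Q where y: "y = (b, P, Q)" by (cases y)
  have "p \<noteq> q" using pq by blast
  consider "P" "Q" | "P" "\<not> Q" | "\<not> P" "Q" | "\<not> P" "\<not> Q" by blast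
  thus ?thesis
  proof cases
    case 1
    hence "{i \<in> {..<6}. (c i, i = p, i = q) = y} = {}" using y \<open>p \<noteq> q\<close> by auto
    thus ?thesis using 1 y by simp
  next
    case 2
    hence "{i \<in> {..<6}. (c i, i = p, i = q) = y} = (if b = c p then {p} else {})" using y \<open>p \<noteq> q\<close> p by auto
    thus ?thesis using 2 y by simp
  next
    case 3
    hence "{i \<in> {..<6}. (c i, i = p, i = q) = y} = (if b = c q then {q} else {})" using y \<open>p \<noteq> q\<close> q by auto
    thus ?thesis using 3 y by simp
  next
    case 4
    hence "{i \<in> {..<6}. (c i, i = p, i = q) = y} = {i. i < 6 \<and> c i = b} - {if c p = b then p else q}"
      using y pq by (cases "c p"; cases b) auto
    moreover have "(if c p = b then p else q) \<in> {i. i < 6 \<and> c i = b}" using p q pq by auto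
    ultimately show ?thesis using 4 y card_colour[of b] by (simp add: card_Diff_subset)
  qed
qed

text \<open>Rearranging the six cap vertices suffices: rungs and colours from 6 on depend only on
  the index and on \<open>c p\<close>.\<close>

lemma isomorphic_same_colour:
  assumes "ladder_cap c' p' q'" "c' p' = c p" "6 \<le> n"
  obtains g where "bij_betw g {..<n} {..<n}" "\<And>i j. L i j \<longleftrightarrow> ladder c' p' q' (g i) (g j)"
proof -
  interpret C': ladder_cap c' p' q' by fact
  have "c' q' = c q" using assms(2) pq C'.pq by blast
  have "card {i \<in> {..<6}. (c i, i = p, i = q) = y} = card {i \<in> {..<6}. (c' i, i = p', i = q') = y}" for y
    unfolding card_class C'.card_class assms(2) \<open>c' q' = c q\<close> ..
  then obtain h where h: "bij_betw h {..<6} {..<6}"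
    "\<And>i. i < 6 \<Longrightarrow> (c' (h i), h i = p', h i = q') = (c i, i = p, i = q)"
    using bij_betw_respecting_fibres[of "{..<6}" "{..<6::nat}" "\<lambda>i. (c i, i = p, i = q)" "\<lambda>i. (c' i, i = p', i = q')"]
    by (metis (no_types, lifting) finite_lessThan lessThan_iff)
  define g where "g i = (if i < 6 then h i else i)" for i
  have h6: "h i < 6" if "i < 6" for i using bij_betwE[OF h(1)] that by simp
  have "bij_betw g {..<6} {..<6}" using h(1) by (rule bij_betw_cong[THEN iffD1, rotated]) (simp add: g_def)
  moreover have "bij_betw g {6..<n} {6..<n}"
    by (rule bij_betw_cong[THEN iffD1, OF _ bij_betw_id]) (simp add: g_def)
  ultimately have "bij_betw g ({..<6} \<union> {6..<n}) ({..<6} \<union> {6..<n})"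
    by (rule bij_betw_combine) auto
  moreover have "{..<6} \<union> {6..<n} = {..<n}" using assms(3) by auto
  ultimately have bij: "bij_betw g {..<n} {..<n}" by simp
  have "rung p' q' (g i) = rung p q i" for i
    using h(2)[of i] h6[of i] p q C'.p C'.q by (auto simp: rung_def g_def)
  moreover have "ladder_colour c' p' (g i) = ladder_colour c p i" for i
    using h(2)[of i] h6[of i] assms(2) by (auto simp: ladder_colour_def g_def)
  ultimately have "L i j \<longleftrightarrow> ladder c' p' q' (g i) (g j)" for i j
    by (simp add: ladder_code C'.ladder_code)
  with bij show ?thesis using that by blast
qed

lemma isomorphic:
  assumes "ladder_cap c' p' q'" "6 \<le> n"
  obtains g where "bij_betw g {..<n} {..<n}" "\<And>i j. L i j \<longleftrightarrow> ladder c' p' q' (g i) (g j)"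
proof (cases "c' p' = c p")
  case True
  thus ?thesis using isomorphic_same_colour[OF assms(1) _ assms(2)] that by blast
next
  case False
  show ?thesis
    using isomorphic_same_colour[OF ladder_cap.complement[OF assms(1)] _ assms(2)] that False
    unfolding ladder_complement by blast
qed

end
section \<open>Rigidity of the edge counts\<close>

context ordered_subcubic begin

context
  fixes c :: "nat \<Rightarrow> bool" and w :: nat
  assumes cap: "ladder_cap c w 5" and w: "w < 5" and n6: "6 \<le> n"
    and same: "\<And>k l. k \<le> n \<Longrightarrow> even l \<Longrightarrow> 6 \<le> l \<Longrightarrow> l \<le> n \<Longrightarrow>
      block_sum E k l = block_sum (ladder c w 5) k l"
begin

interpretation ladder_cap c w 5 by (rule cap)

abbreviation "X b \<equiv> {j. j < 6 \<and> \<gamma> j = b}"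

text \<open>\<open>same\<close> holds for all \<open>k\<close> but only for even \<open>l\<close>,
  so differences of consecutive rows recover each vertex's number of neighbours up to the end of a
  rung.\<close>

lemma nbrs_same:
  assumes "i < n" "even l" "6 \<le> l" "l \<le> n"
  shows "nbrs E i l = nbrs L i l"
  using same[of "Suc i" l] same[of i l] assms by simp

lemma nbrs_top_block: "i < 6 \<Longrightarrow> nbrs E i 6 + of_bool (i = w) + of_bool (i = 5) = 3"
  using nbrs_top[of i] nbrs_same[of i 6] n6 by simp

text \<open>A vertex with three neighbours below 6 forces the opposite class to have at least three
  elements. Two adjacent vertices of this kind bound both classes, which together have six
  elements.\<close>

lemma card_X: "card (X b) = 3"
proof -
  have sub: "{j. j < 6 \<and> E i j} \<subseteq> X (\<not> \<gamma> i)" for i using bip by auto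
  have ge: "3 \<le> card (X (\<not> \<gamma> i))" if "i < 6" "i \<noteq> w" "i \<noteq> 5" for i
    using card_mono[OF _ sub[of i]] nbrs_top_block[of i] that by (simp add: nbrs_card)
  obtain i0 :: nat where i0: "i0 < 6" "i0 \<noteq> w" "i0 \<noteq> 5"
    by (rule that[of "if w = 0 then 1 else 0"]) auto
  \<comment> \<open>Three neighbours do not fit into \<open>{w, 5}\<close>, so \<open>i0\<close> has
    a neighbour that is again saturated.\<close>
  have "\<not> {j. j < 6 \<and> E i0 j} \<subseteq> {w, 5}"
    using card_mono[of "{w, 5}" "{j. j < 6 \<and> E i0 j}"] nbrs_top_block[of i0] i0 w by (auto simp: nbrs_card)
  then obtain i1 where i1: "i1 < 6" "E i0 i1" "i1 \<noteq> w" "i1 \<noteq> 5" by blast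
  have "(\<not> \<gamma> i1) = \<gamma> i0" using bip[OF i1(2)] by blast
  hence "3 \<le> card (X (\<gamma> i0))" "3 \<le> card (X (\<not> \<gamma> i0))" using ge[of i1] ge[of i0] i0 i1 by auto
  moreover have "card (X (\<gamma> i0)) + card (X (\<not> \<gamma> i0)) = card (X (\<gamma> i0) \<union> X (\<not> \<gamma> i0))"
    by (rule card_Un_disjoint[symmetric]) auto
  moreover have "X (\<gamma> i0) \<union> X (\<not> \<gamma> i0) = {..<6}" by auto
  ultimately have "card (X (\<gamma> i0)) = 3" "card (X (\<not> \<gamma> i0)) = 3" by simp_all
  thus ?thesis by (cases "b = \<gamma> i0") auto
qed

lemma top_row: "i < 6 \<Longrightarrow> i \<noteq> w \<Longrightarrow> i \<noteq> 5 \<Longrightarrow> j < 6 \<Longrightarrow> E i j \<longleftrightarrow> \<gamma> i \<noteq> \<gamma> j"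
proof -
  assume i: "i < 6" "i \<noteq> w" "i \<noteq> 5" and j: "j < 6"
  have "{j. j < 6 \<and> E i j} \<subseteq> X (\<not> \<gamma> i)" using bip by auto
  moreover have "card {j. j < 6 \<and> E i j} = card (X (\<not> \<gamma> i))"
    using nbrs_top_block[of i] i card_X by (simp add: nbrs_card)
  ultimately have "{j. j < 6 \<and> E i j} = X (\<not> \<gamma> i)" by (intro card_subset_eq) auto
  thus ?thesis using j by blast
qed

text \<open>Otherwise all three vertices of the other class are saturated inside the cap and hence
  adjacent to \<open>w\<close>, which has only two neighbours below 6. The same count excludes the
  edge in \<open>not_edge_w5\<close>.\<close>

lemma colour_w5: "\<gamma> w \<noteq> \<gamma> 5"
proof
  assume eq: "\<gamma> w = \<gamma> 5"
  have "X (\<not> \<gamma> w) \<subseteq> {j. j < 6 \<and> E w j}"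
  proof
    fix j assume j: "j \<in> X (\<not> \<gamma> w)"
    hence "j \<noteq> w" "j \<noteq> 5" using eq by auto
    hence "E j w" using top_row[of j w] j w by auto
    thus "j \<in> {j. j < 6 \<and> E w j}" using j sym by blast
  qed
  hence "3 \<le> nbrs E w 6" using card_mono[of "{j. j < 6 \<and> E w j}" "X (\<not> \<gamma> w)"] card_X by (simp add: nbrs_card)
  thus False using nbrs_top_block[of w] w by simp
qed

lemma not_edge_w5: "\<not> E w 5"
proof
  assume e: "E w 5"
  have "X (\<not> \<gamma> w) \<subseteq> {j. j < 6 \<and> E w j}"
  proof
    fix j assume j: "j \<in> X (\<not> \<gamma> w)"
    show "j \<in> {j. j < 6 \<and> E w j}"
    proof (cases "j = 5")
      case False
      have "j \<noteq> w" using j by auto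
      hence "E j w" using top_row[of j w] j w False by auto
      thus ?thesis using j sym by blast
    qed (use e in auto)
  qed
  hence "3 \<le> nbrs E w 6" using card_mono[of "{j. j < 6 \<and> E w j}" "X (\<not> \<gamma> w)"] card_X by (simp add: nbrs_card)
  thus False using nbrs_top_block[of w] w by simp
qed

lemma edge_iff_rung_colour_top:
  assumes "i < 6" "j < 6"
  shows "E i j \<longleftrightarrow> rung_adj (rung w 5 i) (rung w 5 j) \<and> \<gamma> i \<noteq> \<gamma> j"
proof -
  have adj: "rung_adj (rung w 5 i) (rung w 5 j) \<longleftrightarrow> \<not> (i \<in> {w, 5} \<and> j \<in> {w, 5})"
    using assms by (auto simp: rung_def rung_adj_def)
  consider "i \<notin> {w, 5}" | "j \<notin> {w, 5}" | "i \<in> {w, 5}" "j \<in> {w, 5}" by blast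
  thus ?thesis
  proof cases
    case 1 thus ?thesis using adj top_row[of i j] assms by auto
  next
    case 2 thus ?thesis using adj top_row[of j i] assms sym_iff[of i j] by auto
  next
    case 3 thus ?thesis using adj not_edge_w5 irrefl sym by auto
  qed
qed

lemma ladder_rung_sum:
  assumes "even k" "6 \<le> k"
  shows "of_bool (L i k) + of_bool (L i (Suc k)) = (of_bool (rung_adj (rung w 5 i) (rung w 5 k)) :: nat)"
proof -
  have "rung w 5 (Suc k) = rung w 5 k" using assms by (simp add: rung_ge_2)
  moreover have "ladder_colour c w (Suc k) \<noteq> ladder_colour c w k"
  proof -
    have "k mod 4 = 0 \<and> Suc k mod 4 = 1 \<or> k mod 4 = 2 \<and> Suc k mod 4 = 3" using assms(1) by presburger
    thus ?thesis using assms(2) by (auto simp: ladder_colour_def)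
  qed
  ultimately show ?thesis by (auto simp: ladder_code)
qed

text \<open>Subtracting the counts at two consecutive ends of rungs isolates one rung. A vertex thus
  has one neighbour in each complete adjacent rung and none in the other complete rungs; the colours
  later decide which one.\<close>

lemma rung_sum:
  assumes "even k" "6 \<le> k" "k + 2 \<le> n" "i < n"
  shows "of_bool (E i k) + of_bool (E i (Suc k)) = (of_bool (rung_adj (rung w 5 i) (rung w 5 k)) :: nat)"
  using nbrs_same[of i k] nbrs_same[of i "Suc (Suc k)"] assms ladder_rung_sum[OF assms(1,2), of i] by simp

lemma rung_edge:
  assumes "even k" "6 \<le> k" "k + 2 \<le> n"
  shows "E k (Suc k)"
proof -
  have "rung_adj (rung w 5 k) (rung w 5 k)" using rung_ge_2[of k] assms by (auto simp: rung_adj_def)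
  thus ?thesis using rung_sum[OF assms, of k] assms irrefl[of k] by (cases "E k (Suc k)") auto
qed

lemma edge_iff_rung_colour_full:
  assumes i: "i < n" and j: "6 \<le> j" "j < n" and full: "even j \<longrightarrow> j + 2 \<le> n"
  shows "E i j \<longleftrightarrow> rung_adj (rung w 5 i) (rung w 5 j) \<and> \<gamma> i \<noteq> \<gamma> j"
proof -
  define k where "k = (if even j then j else j - 1)"
  have "j \<noteq> 6" if "odd j" using that by auto
  hence k: "even k" "6 \<le> k" "k + 2 \<le> n" using assms by (auto simp: k_def)
  have j_cases: "j = k \<or> j = Suc k" using j by (auto simp: k_def)
  have "rung w 5 (Suc k) = rung w 5 k" using k by (simp add: rung_ge_2)
  hence "rung w 5 j = rung w 5 k" using j_cases by auto
  moreover have "\<gamma> k \<noteq> \<gamma> (Suc k)" using bip rung_edge[OF k] by blast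
  ultimately show ?thesis
    using j_cases rung_sum[OF k i] bip[of i k] bip[of i "Suc k"]
    by (cases "E i k"; cases "E i (Suc k)"; cases "rung_adj (rung w 5 i) (rung w 5 k)") auto
qed

text \<open>For odd \<open>n\<close> the last vertex is alone on its rung, and no even threshold up
  to \<open>n\<close> lies beyond it. If it is 6, its single neighbour in the cap must be an
  unsaturated one, \<open>w\<close> or 5, and colour decides; otherwise it has no neighbour in the
  cap.\<close>

lemma edge_iff_rung_colour_last:
  assumes "odd n" "6 < n" "j < 6"
  shows "E (n - 1) j \<longleftrightarrow> rung_adj (rung w 5 (n - 1)) (rung w 5 j) \<and> \<gamma> (n - 1) \<noteq> \<gamma> j"
proof (cases "n = 7")
  case True
  have r: "rung w 5 6 = 2" using rung_ge_2[of 6] by simp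
  have e: "nbrs E 6 6 = 1"
    using nbrs_same[of 6 6] nbrs_down[of 6] True by simp
  have "\<not> E 6 j" if "j < 6" "j \<noteq> w" "j \<noteq> 5" for j
  proof
    assume "E 6 j"
    hence "E j 6" by (rule sym)
    thus False using nbrs_top_block[of j] that nbrs_Suc[of E j 6] nbrs_le_3[of j 7] by simp
  qed
  hence sub: "{j. j < 6 \<and> E 6 j} \<subseteq> {w, 5}" by auto
  obtain j0 where j0: "{j. j < 6 \<and> E 6 j} = {j0}" using e by (auto simp: nbrs_card card_1_singleton_iff)
  hence "j0 \<in> {w, 5}" "E 6 j0" "\<gamma> j0 \<noteq> \<gamma> 6" using sub bip[of 6 j0] by auto
  moreover have "E 6 j \<longleftrightarrow> j = j0" using j0 assms(3) by blast
  ultimately have "E 6 j \<longleftrightarrow> j \<in> {w, 5} \<and> \<gamma> 6 \<noteq> \<gamma> j" using colour_w5 by auto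
  moreover have "rung_adj (rung w 5 6) (rung w 5 j) \<longleftrightarrow> j \<in> {w, 5}"
    unfolding r using assms(3) by (auto simp: rung_adj_def rung_def)
  ultimately show ?thesis using True by simp
next
  case False
  hence n8: "8 \<le> n - 1" using assms by presburger
  have "\<not> L (n - 1) i" if "i < 6" for i using n8 that by (auto simp: ladder_down_iff down_def)
  hence "nbrs L (n - 1) 6 = 0" by (auto simp: nbrs_card)
  hence "nbrs E (n - 1) 6 = 0" using nbrs_same[of "n - 1" 6] assms by simp
  hence "\<not> E (n - 1) j" using assms(3) by (auto simp: nbrs_card)
  moreover have "3 \<le> rung w 5 (n - 1)" using n8 div_le_mono[OF n8, of 2] rung_ge_2(1)[of "n - 1"] by linarith
  moreover have "rung w 5 j \<le> 1" using assms rung_le_1 by blast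
  ultimately show ?thesis by (auto simp: rung_adj_def)
qed

lemma edge_iff_rung_colour:
  assumes "i < n" "j < n"
  shows "E i j \<longleftrightarrow> rung_adj (rung w 5 i) (rung w 5 j) \<and> \<gamma> i \<noteq> \<gamma> j"
proof -
  have last: "l = n - 1 \<and> odd n" if "6 \<le> l" "l < n" "\<not> (even l \<longrightarrow> l + 2 \<le> n)" for l
  proof -
    have "even l" "n = l + 1" using that by auto
    thus ?thesis by simp
  qed
  have "i < 6 \<or> 6 \<le> i" "j < 6 \<or> 6 \<le> j" by linarith+
  then consider "i < 6" "j < 6" | "6 \<le> j" "even j \<longrightarrow> j + 2 \<le> n" | "6 \<le> i" "even i \<longrightarrow> i + 2 \<le> n"
    | "i = n - 1" "odd n" "6 \<le> i" "j < 6" | "j = n - 1" "odd n" "6 \<le> j" "i < 6" | "i = n - 1" "j = n - 1"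
    using last[of i] last[of j] assms by blast
  thus ?thesis
  proof cases
    case 1 thus ?thesis by (rule edge_iff_rung_colour_top)
  next
    case 2 thus ?thesis using edge_iff_rung_colour_full[of i j] assms by blast
  next
    case 3 thus ?thesis
      using edge_iff_rung_colour_full[of j i] assms sym_iff[of i j] rung_adj_commute by metis
  next
    case 4 thus ?thesis using edge_iff_rung_colour_last[of j] assms by simp
  next
    case 5 thus ?thesis
      using edge_iff_rung_colour_last[of i] assms sym_iff[of i j] rung_adj_commute[of "rung w 5 i"] by auto
  next
    case 6 thus ?thesis using irrefl by simp
  qed
qed

text \<open>G has the adjacency rule of a ladder, but with \<open>\<gamma>\<close> in place of the
  ladder colouring. Swapping the ends of some rungs reconciles the two colourings.\<close>

lemma isomorphic_if_block_sums_eq: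
  assumes "ladder_cap c' p' q'"
  obtains f where "bij_betw f {..<n} {..<n}"
    "\<And>i j. i < n \<Longrightarrow> j < n \<Longrightarrow> E i j \<longleftrightarrow> ladder c' p' q' (f i) (f j)"
proof -
  have "ladder_cap \<gamma> w 5" using card_X[of True] w colour_w5 by unfold_locales auto
  hence caps: "ladder_cap \<gamma> w 5" "ladder_cap \<gamma> 5 w" using ladder_cap.swap by auto
  have flip: "ladder_colour \<gamma> 5 (n - 1) \<noteq> ladder_colour \<gamma> w (n - 1)" if "6 \<le> n - 1"
    using that colour_w5 by (auto simp: ladder_colour_def)
  \<comment> \<open>Exchanging \<open>w\<close> and 5 flips every ladder colour from 6 on, so the
    last vertex can be given the right colour. For odd \<open>n\<close> it has no partner to be
    swapped with.\<close>
  obtain p q where pq: "ladder_cap \<gamma> p q" "{p, q} = {w, 5}"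
    and last: "6 \<le> n - 1 \<Longrightarrow> ladder_colour \<gamma> p (n - 1) = \<gamma> (n - 1)"
    using caps flip by (cases "ladder_colour \<gamma> w (n - 1) = \<gamma> (n - 1)") (metis insert_commute)+
  interpret G: ladder_cap \<gamma> p q by fact
  have rung_pq: "rung p q = rung w 5"
    using pq(2) by (auto simp: rung_def fun_eq_iff doubleton_eq_iff)
  \<comment> \<open>Vertices whose colour disagrees with the ladder trade places with the other end
    of their rung; cap vertices never disagree.\<close>
  define f where "f i = (if ladder_colour \<gamma> p i = \<gamma> i then i else if even i then Suc i else i - 1)" for i
  have partner: "f i < n \<and> rung p q (f i) = rung p q i \<and> ladder_colour \<gamma> p (f i) = \<gamma> i \<and> f (f i) = i"
    if i: "i < n" for i
  proof (cases "ladder_colour \<gamma> p i = \<gamma> i")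
    case True
    thus ?thesis using i by (simp add: f_def)
  next
    case False
    hence i6: "6 \<le> i" by (auto simp: ladder_colour_def split: if_splits)
    define k where "k = (if even i then i else i - 1)"
    have "i \<noteq> 6" if "odd i" using that by auto
    moreover have "i \<noteq> n - 1 \<or> \<not> 6 \<le> n - 1" using False last by blast
    ultimately have k: "even k" "6 \<le> k" "k + 2 \<le> n" using i i6 by (auto simp: k_def)
    have ik: "i = k \<and> f i = Suc k \<or> i = Suc k \<and> f i = k" using False i6 by (auto simp: k_def f_def)
    have "\<gamma> k \<noteq> \<gamma> (Suc k)" using bip rung_edge[OF k] by blast
    moreover have "ladder_colour \<gamma> p (Suc k) \<noteq> ladder_colour \<gamma> p k"
    proof -
      have "k mod 4 = 0 \<and> Suc k mod 4 = 1 \<or> k mod 4 = 2 \<and> Suc k mod 4 = 3" using k(1) by presburger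
      thus ?thesis using k(2) by (auto simp: ladder_colour_def)
    qed
    ultimately have swapped: "ladder_colour \<gamma> p k \<noteq> \<gamma> k" "ladder_colour \<gamma> p (Suc k) \<noteq> \<gamma> (Suc k)"
      using False ik by auto
    hence "f k = Suc k" "f (Suc k) = k" using k(1) by (simp_all add: f_def)
    moreover have "rung p q (Suc k) = rung p q k" using k by (simp add: G.rung_ge_2)
    ultimately show ?thesis using ik k(3) swapped \<open>\<gamma> k \<noteq> \<gamma> (Suc k)\<close> by auto
  qed
  have bij: "bij_betw f {..<n} {..<n}"
    by (rule bij_betw_byWitness[where f' = f]) (use partner in auto)
  have iso: "E i j \<longleftrightarrow> ladder \<gamma> p q (f i) (f j)" if "i < n" "j < n" for i j
    using edge_iff_rung_colour[OF that] partner[OF that(1)] partner[OF that(2)] by (simp add: G.ladder_code rung_pq)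
  obtain g where g: "bij_betw g {..<n} {..<n}" "\<And>i j. ladder \<gamma> p q i j \<longleftrightarrow> ladder c' p' q' (g i) (g j)"
    using G.isomorphic[OF assms n6] by blast
  show ?thesis
    by (rule that[of "g \<circ> f"]) (use bij g iso in \<open>auto intro: bij_betw_trans\<close>)
qed

end

end

section \<open>Summation by parts\<close>

lemma abel_summation:
  fixes a x :: "nat \<Rightarrow> real"
  shows "(\<Sum>j<n. a j * x j) = (\<Sum>l<n. (x l - x (Suc l)) * (\<Sum>j<Suc l. a j)) + x n * (\<Sum>j<n. a j)"
  by (induction n) (simp_all add: algebra_simps)

definition nbr_sum :: "nat \<Rightarrow> (nat \<Rightarrow> nat \<Rightarrow> bool) \<Rightarrow> (nat \<Rightarrow> real) \<Rightarrow> nat \<Rightarrow> real" where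
  "nbr_sum n E x i = (\<Sum>j<n. of_bool (E i j) * x j)"

lemma nbr_sum_eq_sum:
  assumes "finite N" "\<And>j. E i j \<longleftrightarrow> j \<in> N" "\<And>j. n \<le> j \<Longrightarrow> x j = 0"
  shows "nbr_sum n E x i = sum x N"
proof -
  have "nbr_sum n E x i = (\<Sum>j<n. if j \<in> N then x j else 0)"
    unfolding nbr_sum_def by (rule sum.cong) (simp_all add: assms(2))
  also have "\<dots> = (\<Sum>j\<in>{..<n} \<inter> N. x j)" by (simp add: sum.inter_restrict)
  also have "\<dots> = sum x N"
    by (rule sum.mono_neutral_left) (use assms(1,3) in \<open>simp, blast, metis Diff_iff Int_iff lessThan_iff not_less\<close>)
  finally show ?thesis .
qed

lemma sum_nbr_sum:
  assumes "x n = 0"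
  shows "(\<Sum>i<k. nbr_sum n E x i) = (\<Sum>l<n. (x l - x (Suc l)) * real (block_sum E k (Suc l)))"
proof -
  have "(\<Sum>i<k. nbr_sum n E x i) = (\<Sum>j<n. (\<Sum>i<k. of_bool (E i j)) * x j)"
    unfolding nbr_sum_def sum_distrib_right by (rule sum.swap)
  also have "\<dots> = (\<Sum>l<n. (x l - x (Suc l)) * (\<Sum>j<Suc l. \<Sum>i<k. of_bool (E i j)))"
    unfolding abel_summation[of "\<lambda>j. \<Sum>i<k. of_bool (E i j)"] assms by simp
  also have "(\<lambda>l. \<Sum>j<Suc l. \<Sum>i<k. of_bool (E i j)) = (\<lambda>l. real (block_sum E k (Suc l)))"
    unfolding block_sum_def nbrs_def of_nat_sum of_nat_of_bool by (intro ext sum.swap)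
  finally show ?thesis by (simp only: fun_eq_iff)
qed

locale dominated_pair =
  fixes n :: nat and E F :: "nat \<Rightarrow> nat \<Rightarrow> bool" and x :: "nat \<Rightarrow> real"
  assumes dom: "\<And>k l. k \<le> n \<Longrightarrow> l \<le> n \<Longrightarrow> block_sum E k l \<le> block_sum F k l"
    and decr: "\<And>i j. i \<le> j \<Longrightarrow> x j \<le> x i"
    and zero: "\<And>i. n \<le> i \<Longrightarrow> x i = 0"
begin

lemma gap_nonneg: "0 \<le> x l - x (Suc l)"
  using decr[of l "Suc l"] by simp

lemma sum_nbr_sum_le:
  assumes "k \<le> n"
  shows "(\<Sum>i<k. nbr_sum n E x i) \<le> (\<Sum>i<k. nbr_sum n F x i)"
proof -
  have "x n = 0" by (rule zero) simp
  thus ?thesis unfolding sum_nbr_sum[where x = x and n = n, OF \<open>x n = 0\<close>]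
    using dom assms by (intro sum_mono mult_left_mono gap_nonneg) auto
qed

lemma form_le: "(\<Sum>i<n. nbr_sum n E x i * x i) \<le> (\<Sum>i<n. nbr_sum n F x i * x i)"
proof -
  have "x n = 0" by (rule zero) simp
  moreover have "(x l - x (Suc l)) * (\<Sum>i<Suc l. nbr_sum n E x i) \<le> (x l - x (Suc l)) * (\<Sum>i<Suc l. nbr_sum n F x i)"
    if "l < n" for l
    using that by (intro mult_left_mono[OF sum_nbr_sum_le gap_nonneg]) simp
  ultimately show ?thesis unfolding abel_summation[of _ x n]
    by (auto intro!: add_mono sum_mono simp del: sum.lessThan_Suc)
qed

text \<open>Equal neighbour sums make a combination of the deficits of \<open>E\<close> against
  \<open>F\<close>, weighted by the nonnegative gaps, vanish term by term. Rows are merely added up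
  to \<open>k\<close>, so only the column gap at \<open>l\<close> has to be positive.\<close>

lemma block_sum_eq_if_gap:
  assumes eq: "\<And>i. i < n \<Longrightarrow> nbr_sum n E x i = nbr_sum n F x i"
    and gap: "x (Suc l) < x l" and kl: "k \<le> n" "l < n"
  shows "block_sum E k (Suc l) = block_sum F k (Suc l)"
proof -
  have x0: "x n = 0" by (rule zero) simp
  have "(\<Sum>i<k. nbr_sum n E x i) = (\<Sum>i<k. nbr_sum n F x i)"
    using eq kl by (intro sum.cong) auto
  hence "(\<Sum>l<n. (x l - x (Suc l)) * (real (block_sum F k (Suc l)) - real (block_sum E k (Suc l)))) = 0"
    unfolding sum_nbr_sum[where x = x and n = n, OF x0] by (simp add: right_diff_distrib sum_subtractf)
  moreover have "0 \<le> (x l - x (Suc l)) * (real (block_sum F k (Suc l)) - real (block_sum E k (Suc l)))"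
    if "l < n" for l
    using dom[of k "Suc l"] kl that gap_nonneg by (intro mult_nonneg_nonneg) auto
  ultimately have "(x l - x (Suc l)) * (real (block_sum F k (Suc l)) - real (block_sum E k (Suc l))) = 0"
    using kl(2) by (subst (asm) sum_nonneg_eq_0_iff) auto
  thus ?thesis using gap by simp
qed

end

section \<open>Positivity of the Perron vector and the bound 3 on its eigenvalue\<close>

context ordered_subcubic
begin

context
  fixes x :: "nat \<Rightarrow> real" and \<mu> :: real
  assumes eigen: "\<And>i. i < n \<Longrightarrow> nbr_sum n E x i = \<mu> * x i"
    and decr: "\<And>i j. i \<le> j \<Longrightarrow> x j \<le> x i"
    and zero: "\<And>i. n \<le> i \<Longrightarrow> x i = 0"
    and nz: "\<exists>i<n. x i \<noteq> 0"
begin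

lemma eigenvector_nonneg: "0 \<le> x i"
  using decr[of i "max i n"] zero[of "max i n"] by simp

text \<open>As \<open>x\<close> decreases, its zeros form a final segment. Across the cut before it
  runs an edge, and the eigenvalue equation at its far end equates a positive sum with 0.\<close>

lemma eigenvector_pos:
  assumes "i < n"
  shows "0 < x i"
proof (rule ccontr)
  assume "\<not> 0 < x i"
  hence ex: "x i = 0" using eigenvector_nonneg[of i] by simp
  define k where "k = (LEAST i. x i = 0)"
  have k: "x k = 0" unfolding k_def by (rule LeastI[of _ i]) (rule ex)
  have "k \<le> i" unfolding k_def by (rule Least_le) (rule ex)
  have pos: "0 < x j" if "j < k" for j
    using not_less_Least[of j "\<lambda>i. x i = 0"] that eigenvector_nonneg[of j] unfolding k_def by simp
  obtain m where "x m \<noteq> 0" using nz by blast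
  hence "0 < x 0" using decr[of 0 m] eigenvector_nonneg[of m] by simp
  hence "0 < k" using k by (cases k) auto
  then obtain i' j where ij: "i' < k" "k \<le> j" "E i' j" using cut \<open>k \<le> i\<close> assms by (meson le_less_trans)
  have "x j = 0" using decr[OF ij(2)] eigenvector_nonneg[of j] k by simp
  have "j < n" using bounded ij by blast
  have "x i' = of_bool (E j i') * x i'" using ij sym by simp
  also have "\<dots> \<le> nbr_sum n E x j"
    unfolding nbr_sum_def
    by (rule member_le_sum[of i' "{..<n}" "\<lambda>i. of_bool (E j i) * x i"])
      (use ij \<open>k \<le> i\<close> assms eigenvector_nonneg in auto)
  also have "\<dots> = 0" using eigen[OF \<open>j < n\<close>] \<open>x j = 0\<close> by simp
  finally show False using pos[OF ij(1)] by simp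
qed

text \<open>Summing all eigenvalue equations weights each positive entry by its degree, which is at
  most 3 and once smaller.\<close>

lemma eigenvalue_lt_3: "\<mu> < 3"
proof -
  obtain i0 where i0: "i0 < n" "nbrs E i0 n < 3" using deficient by blast
  have "\<mu> * (\<Sum>i<n. x i) = (\<Sum>i<n. nbr_sum n E x i)"
    using eigen by (simp add: sum_distrib_left)
  also have "\<dots> = (\<Sum>j<n. \<Sum>i<n. of_bool (E i j) * x j)"
    unfolding nbr_sum_def by (rule sum.swap)
  also have "\<dots> = (\<Sum>j<n. real (nbrs E j n) * x j)"
    unfolding nbrs_def of_nat_sum sum_distrib_right by (intro sum.cong refl) (simp add: sym_iff)
  also have "\<dots> < (\<Sum>j<n. 3 * x j)"
    by (intro sum_strict_mono_ex1 ballI bexI[of _ i0])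
      (use i0 eigenvector_pos deg in \<open>auto intro!: mult_right_mono eigenvector_nonneg simp: le_numeral_extra\<close>)
  also have "\<dots> = 3 * (\<Sum>i<n. x i)" by (simp add: sum_distrib_left)
  finally have "\<mu> * (\<Sum>i<n. x i) < 3 * (\<Sum>i<n. x i)" .
  moreover have "0 \<le> (\<Sum>i<n. x i)" using eigenvector_nonneg by (intro sum_nonneg) auto
  ultimately show ?thesis by (meson mult_less_cancel_right not_less)
qed

end

end

context ladder_cap
begin

text \<open>A vanishing gap between two consecutive pairs of vertices forces, through the eigenvalue
  equations, three neighbours with equal entries and hence the eigenvalue 3.\<close>

lemma ladder_gap_pos:
  fixes x :: "nat \<Rightarrow> real"
  assumes top: "q = 5" "p < 5"
    and eigen: "\<And>i. i < n \<Longrightarrow> nbr_sum n L x i = \<mu> * x i"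
    and decr: "\<And>i j. i \<le> j \<Longrightarrow> x j \<le> x i"
    and zero: "\<And>i. n \<le> i \<Longrightarrow> x i = 0"
    and pos: "\<And>i. i < n \<Longrightarrow> 0 < x i"
    and mu: "\<mu> < 3"
    and k: "even k" "6 \<le> k" "k \<le> n"
  shows "x k < x (k - 1)"
proof (cases "k = n")
  case True
  thus ?thesis using pos[of "k - 1"] zero[of k] k by simp
next
  case False
  hence kn: "k < n" using k by simp
  show ?thesis
  proof (rule ccontr)
    assume "\<not> x k < x (k - 1)"
    hence eq: "x (k - 1) = x k" using decr[of "k - 1" k] by simp
    have not3: "\<mu> * x k \<noteq> 3 * x k" using pos[OF kn] mu by simp
    show False
    proof (cases "k = 6")
      case False
      \<comment> \<open>The shift by 4 writes the neighbours of \<open>k\<close> and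
        \<open>k - 1\<close> without subtraction.\<close>
      obtain m where m: "k = m + 4" "even m" "4 \<le> m"
      proof (rule that[of "k - 4"])
        have "8 \<le> k" using False k by presburger
        thus "k = k - 4 + 4" "even (k - 4)" "4 \<le> k - 4" using k by simp_all
      qed
      have "nbr_sum n L x k = sum x {m + 2, m + 5, m + 6}"
        by (rule nbr_sum_eq_sum) (use m zero in \<open>auto simp: ladder_def down_def\<close>)
      moreover have "nbr_sum n L x (k - 1) = sum x {m + 1, m + 2, m + 5}"
      proof (rule nbr_sum_eq_sum)
        have km: "k - 1 = m + 3" using m(1) by simp
        have up: "L (k - 1) j \<longleftrightarrow> j = m + 5" if "j > m + 3" for j
        proof -
          have "L (k - 1) j \<longleftrightarrow> down c p q j (m + 3)"
            unfolding km ladder_sym[of c p q "m + 3" j] by (rule ladder_down_iff[OF that])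
          also have "\<dots> \<longleftrightarrow> m + 3 = j - 2 \<or> odd j \<and> m + 3 = j - 1"
            using that m(3) by (simp add: down_def)
          also have "\<dots> \<longleftrightarrow> j = m + 5"
          proof -
            have "even j" if "m + 3 = j - 1" using that m(2) \<open>j > m + 3\<close> by presburger
            thus ?thesis using that by linarith
          qed
          finally show ?thesis .
        qed
        have dn: "L (k - 1) j \<longleftrightarrow> j = m + 1 \<or> j = m + 2" if "j < m + 3" for j
        proof (cases "m = 4")
          case True
          thus ?thesis unfolding km using ladder_down_iff[OF that] that top(1) by (simp add: down_def)
        next
          case False
          hence "8 \<le> m + 3" "odd (m + 3)" using m(2,3) by presburger+
          thus ?thesis unfolding km using ladder_down_iff[OF that] that by (auto simp: down_def)
        qed
        show "L (k - 1) j \<longleftrightarrow> j \<in> {m + 1, m + 2, m + 5}" for j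
          using up[of j] dn[of j] not_ladder_diag[of "m + 3"] unfolding km
          by (cases j "m + 3" rule: linorder_cases) auto
      qed (use zero in simp_all)
      ultimately have e: "\<mu> * x k = x (m + 2) + x (m + 5) + x (m + 6)"
        "\<mu> * x (k - 1) = x (m + 1) + x (m + 2) + x (m + 5)"
        using eigen[OF kn] eigen[OF less_imp_diff_less[OF kn, of 1]] by simp_all
      \<comment> \<open>The equations at \<open>k\<close> and \<open>k - 1\<close> share two
        neighbours. Equating the third ones squeezes all entries between \<open>m + 1\<close> and
        \<open>m + 6\<close> to one value.\<close>
      hence "x (m + 1) = x (m + 6)" using eq by simp
      moreover have "x (m + 2) \<le> x (m + 1)" "x (m + 4) \<le> x (m + 2)" "x (m + 5) \<le> x (m + 4)" "x (m + 6) \<le> x (m + 5)"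
        by (rule decr; simp)+
      ultimately have "\<mu> * x k = 3 * x k" using e(1) m(1) by simp
      thus False using not3 by blast
    next
      case True
      \<comment> \<open>\<open>D\<close> consists of the common neighbours in the cap of the whole
        class of \<open>p\<close>; \<open>A\<close> is that class without \<open>p\<close>. If 5 and
        6 have equal entries, so do \<open>p\<close> and \<open>A\<close>, and comparing the
        equations at 5 and 6 gives \<open>x p = x 8\<close>.\<close>
      define D where "D = {j. j < 6 \<and> c j \<noteq> c p \<and> j \<noteq> 5}"
      define A where "A = {j. j < 6 \<and> c j = c p \<and> j \<noteq> p}"
      have "A = {j. j < 6 \<and> c j = c p} - {p}" by (auto simp: A_def)
      hence cA: "card A = 2" using card_colour[of "c p"] p by simp
      have c5: "c 5 \<noteq> c p" using pq top by auto
      have "nbr_sum n L x p = sum x (insert 6 D)"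
        by (rule nbr_sum_eq_sum) (use zero top c5 in \<open>auto simp: D_def ladder_def down_def doubleton_eq_iff, (metis linorder_neqE_nat)+\<close>)
      hence ep: "\<mu> * x p = sum x D + x 6" using eigen[of p] kn True top by (simp add: D_def)
      have ea: "\<mu> * x a = sum x D + x 5" if a: "a \<in> A" for a
      proof -
        have "a \<noteq> 5" using a c5 by (auto simp: A_def)
        hence "nbr_sum n L x a = sum x (insert 5 D)"
          by (intro nbr_sum_eq_sum) (use a zero top c5 in \<open>auto simp: A_def D_def ladder_def down_def doubleton_eq_iff, (metis linorder_neqE_nat)+\<close>)
        thus ?thesis using eigen[of a] a kn True by (simp add: A_def D_def)
      qed
      have "nbr_sum n L x 6 = sum x {p, 7, 8}"
        by (rule nbr_sum_eq_sum) (use zero top in \<open>auto simp: ladder_def down_def\<close>)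
      hence e6: "\<mu> * x 6 = x p + x 7 + x 8" using eigen[of 6] kn True p by simp
      have five: "j < 5" if "j < 6" "j \<noteq> 5" for j :: nat using that by linarith
      have "nbr_sum n L x 5 = sum x (insert 7 A)"
        by (rule nbr_sum_eq_sum) (use zero top c5 in \<open>auto simp: A_def ladder_def down_def doubleton_eq_iff, (metis five)+\<close>)
      hence e5: "\<mu> * x 5 = sum x A + x 7" using eigen[of 5] kn True by (simp add: A_def)
      have x56: "x 5 = x 6" using eq True by simp
      have nn: "0 \<le> x i" for i using pos[of i] zero[of i] by (cases "i < n") auto
      have "0 < \<mu> * x 6" using e6 pos[of p] kn True p nn[of 7] nn[of 8] by simp
      hence mu0: "0 < \<mu>" using pos[of 6] kn True by (simp add: zero_less_mult_iff)
      have "x a = x p" if "a \<in> A" for a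
      proof -
        have "\<mu> * x a = \<mu> * x p" using ea[OF that] ep x56 by simp
        thus ?thesis using mu0 by simp
      qed
      hence "sum x A = 2 * x p" using cA by simp
      hence "x p = x 8" using e5 e6 x56 by simp
      moreover have "x 5 \<le> x p" "x 7 \<le> x 6" "x 8 \<le> x 7" using top by (auto intro: decr)
      ultimately have "\<mu> * x k = 3 * x k" using e6 x56 True by simp
      thus False using not3 by blast
    qed
  qed
qed

end

section \<open>The dominating ladder and its equality case\<close>

context ordered_subcubic
begin

context
  fixes x :: "nat \<Rightarrow> real" and \<mu> :: real
  assumes n6: "6 \<le> n"
    and eigen: "\<And>i. i < n \<Longrightarrow> nbr_sum n E x i = \<mu> * x i"
    and decr: "\<And>i j. i \<le> j \<Longrightarrow> x j \<le> x i"
    and zero: "\<And>i. n \<le> i \<Longrightarrow> x i = 0"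
    and nz: "\<exists>i<n. x i \<noteq> 0"
begin

text \<open>The cap depends on G, so the inequality and the rigidity statement are bundled to speak
  of the same one. The target cap of the isomorphism is left arbitrary so that the cap of
  \<open>B n\<close> can be inserted.\<close>

lemma dominating_ladder:
  "\<exists>c w. ladder_cap c w 5 \<and>
    \<mu> * (\<Sum>i<n. (x i)\<^sup>2) \<le> (\<Sum>i<n. nbr_sum n (ladder c w 5) x i * x i) \<and>
    ((\<forall>i<n. nbr_sum n (ladder c w 5) x i = \<mu> * x i) \<longrightarrow>
      (\<forall>c' p' q'. ladder_cap c' p' q' \<longrightarrow>
        (\<exists>f. bij_betw f {..<n} {..<n} \<and> (\<forall>i<n. \<forall>j<n. E i j \<longleftrightarrow> ladder c' p' q' (f i) (f j)))))"
proof -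
  obtain c w where cap: "ladder_cap c w 5" and w: "w < 5"
    and dom: "\<And>k l. k \<le> n \<Longrightarrow> l \<le> n \<Longrightarrow> block_sum E k l \<le> block_sum (ladder c w 5) k l"
    using ex_dominating_cap[OF n6] by metis
  interpret ladder_cap c w 5 by (rule cap)
  interpret dominated_pair n E L x by unfold_locales (use dom decr zero in auto)
  have "\<mu> * (\<Sum>i<n. (x i)\<^sup>2) = (\<Sum>i<n. nbr_sum n E x i * x i)"
    using eigen by (simp add: sum_distrib_left power2_eq_square mult.assoc)
  hence le: "\<mu> * (\<Sum>i<n. (x i)\<^sup>2) \<le> (\<Sum>i<n. nbr_sum n L x i * x i)"
    using form_le by simp
  have iso: "\<exists>f. bij_betw f {..<n} {..<n} \<and> (\<forall>i<n. \<forall>j<n. E i j \<longleftrightarrow> ladder c' p' q' (f i) (f j))"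
    if L: "\<And>i. i < n \<Longrightarrow> nbr_sum n L x i = \<mu> * x i" and cap': "ladder_cap c' p' q'" for c' p' q'
  proof -
    have same: "block_sum E k l = block_sum L k l" if kl: "k \<le> n" "even l" "6 \<le> l" "l \<le> n" for k l
    proof -
      obtain m where m: "l = Suc m" using kl by (cases l) auto
      have gap: "x l < x (l - 1)"
        by (rule ladder_gap_pos[OF refl w L decr zero eigenvector_pos[OF eigen decr zero nz]
            eigenvalue_lt_3[OF eigen decr zero nz] kl(2-4)])
      show ?thesis unfolding m
      proof (rule block_sum_eq_if_gap)
        show "nbr_sum n E x i = nbr_sum n L x i" if "i < n" for i using eigen[OF that] L[OF that] by simp
      qed (use gap m kl in simp_all)
    qed
    show ?thesis
    proof (rule isomorphic_if_block_sums_eq[OF cap w n6 same cap'])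
      fix f
      assume "bij_betw f {..<n} {..<n}"
        "\<And>i j. i < n \<Longrightarrow> j < n \<Longrightarrow> E i j \<longleftrightarrow> ladder c' p' q' (f i) (f j)"
      thus ?thesis by blast
    qed
  qed
  show ?thesis
  proof (intro exI[of _ c] exI[of _ w] conjI impI allI)
    fix c' p' q'
    assume "\<forall>i<n. nbr_sum n L x i = \<mu> * x i" "ladder_cap c' p' q'"
    thus "\<exists>f. bij_betw f {..<n} {..<n} \<and> (\<forall>i<n. \<forall>j<n. E i j \<longleftrightarrow> ladder c' p' q' (f i) (f j))"
      by (intro iso) simp_all
  qed (fact cap le)+
qed

end

end

section \<open>Spectral radius and isomorphism\<close>

definition adj :: "'a pair_pre_digraph \<Rightarrow> 'a \<Rightarrow> 'a \<Rightarrow> real" where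
  "adj G u v = of_bool ((u, v) \<in> parcs G)"

text \<open>The maximum \<open>m\<close> of the Rayleigh quotient is an eigenvalue of the adjacency
  matrix, and any other eigenvalue is the quotient at its eigenvector, hence at most
  \<open>m\<close>.\<close>

lemma lambda1_rayleigh:
  fixes G :: "'a pair_pre_digraph"
  assumes fin: "finite (pverts G)" and ne: "pverts G \<noteq> {}" and sym: "sym (parcs G)"
  obtains x where "\<And>v. 0 \<le> x v" "\<exists>v\<in>pverts G. x v \<noteq> 0"
    "\<And>u. u \<in> pverts G \<Longrightarrow> (\<Sum>v\<in>pverts G. adj G u v * x v) = lambda1 G * x u"
    "\<And>z. quad_form (pverts G) (adj G) z \<le> lambda1 G * (\<Sum>v\<in>pverts G. (z v)\<^sup>2)"
proof -
  have adj_sym: "adj G u v = adj G v u" for u v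
    using sym by (auto simp: adj_def sym_def)
  obtain m x where x: "\<And>v. 0 \<le> x v" "\<exists>v\<in>pverts G. x v \<noteq> 0"
    "\<And>u. u \<in> pverts G \<Longrightarrow> (\<Sum>v\<in>pverts G. adj G u v * x v) = m * x u"
    "\<And>z. quad_form (pverts G) (adj G) z \<le> m * (\<Sum>v\<in>pverts G. (z v)\<^sup>2)"
    by (rule nonneg_symmetric_eigenvector[OF fin ne, of "adj G"]) (use adj_sym in \<open>auto simp: adj_def\<close>)
  define vs where "vs = (SOME vs. distinct vs \<and> set vs = pverts G)"
  have "\<exists>vs. distinct vs \<and> set vs = pverts G" using finite_distinct_list[OF fin] by blast
  hence vs: "distinct vs" "set vs = pverts G"
    using someI_ex[of "\<lambda>vs. distinct vs \<and> set vs = pverts G"] unfolding vs_def by auto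
  define N where "N = length vs"
  have bij: "bij_betw (\<lambda>i. vs ! i) {0..<N} (pverts G)"
    using bij_betw_nth[OF vs(1), of "{0..<N}" "pverts G"] vs by (auto simp: N_def atLeast0LessThan)
  have reindex: "(\<Sum>v\<in>pverts G. g v) = (\<Sum>i = 0..<N. g (vs ! i))" for g :: "'a \<Rightarrow> real"
    by (rule sum.reindex_bij_betw[OF bij, symmetric])
  define A where "A = adjacency_matrix vs G"
  have A: "A \<in> carrier_mat N N" by (simp add: A_def adjacency_matrix_def N_def)
  have entry: "A $$ (i, j) = adj G (vs ! i) (vs ! j)" if "i < N" "j < N" for i j
    using that by (simp add: A_def adjacency_matrix_def adj_def N_def)
  have Av: "(A *\<^sub>v v) $ i = (\<Sum>j = 0..<N. adj G (vs ! i) (vs ! j) * v $ j)"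
    if "i < N" "v \<in> carrier_vec N" for v i
    using that A by (simp add: scalar_prod_def entry)
  have le: "k \<le> m" if ev: "eigenvalue A k" for k
  proof -
    obtain v where v: "v \<in> carrier_vec N" "v \<noteq> 0\<^sub>v N" "A *\<^sub>v v = k \<cdot>\<^sub>v v"
      using ev A unfolding eigenvalue_def eigenvector_def by auto
    define z where "z u = v $ (the_inv_into {0..<N} (\<lambda>i. vs ! i) u)" for u
    have z: "z (vs ! i) = v $ i" if "i < N" for i
      using the_inv_into_f_f[OF bij_betw_imp_inj_on[OF bij], of i] that by (simp add: z_def)
    have "quad_form (pverts G) (adj G) z
        = (\<Sum>i = 0..<N. (\<Sum>j = 0..<N. adj G (vs ! i) (vs ! j) * v $ j) * v $ i)"
      unfolding quad_form_def reindex sum_distrib_right by (intro sum.cong) (auto simp: z mult_ac)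
    also have "\<dots> = (\<Sum>i = 0..<N. (k * v $ i) * v $ i)"
    proof (rule sum.cong[OF refl])
      fix i assume "i \<in> {0..<N}"
      hence "(\<Sum>j = 0..<N. adj G (vs ! i) (vs ! j) * v $ j) = k * v $ i"
        using Av[of i v] v by simp
      thus "(\<Sum>j = 0..<N. adj G (vs ! i) (vs ! j) * v $ j) * v $ i = (k * v $ i) * v $ i" by simp
    qed
    also have "\<dots> = k * (\<Sum>v\<in>pverts G. (z v)\<^sup>2)"
      unfolding reindex sum_distrib_left by (intro sum.cong) (auto simp: z power2_eq_square)
    finally have "k * (\<Sum>v\<in>pverts G. (z v)\<^sup>2) \<le> m * (\<Sum>v\<in>pverts G. (z v)\<^sup>2)"
      using x(4)[of z] by simp
    moreover have "0 < (\<Sum>v\<in>pverts G. (z v)\<^sup>2)"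
    proof -
      obtain i where i: "i < N" "v $ i \<noteq> 0" using v(1,2) by (metis carrier_vecD eq_vecI index_zero_vec)
      hence "vs ! i \<in> pverts G" "z (vs ! i) \<noteq> 0" using vs(2) z by (auto simp: N_def)
      thus ?thesis using fin by (intro sum_pos2) auto
    qed
    ultimately show ?thesis by simp
  qed
  have "eigenvector A (vec N (\<lambda>i. x (vs ! i))) m"
    unfolding eigenvector_def
  proof (intro conjI)
    show "vec N (\<lambda>i. x (vs ! i)) \<in> carrier_vec (dim_row A)" using A by simp
    obtain v where v: "v \<in> pverts G" "x v \<noteq> 0" using x(2) by blast
    obtain i where i: "i < N" "vs ! i = v" using v(1) vs(2) unfolding N_def by (metis in_set_conv_nth)
    show "vec N (\<lambda>i. x (vs ! i)) \<noteq> 0\<^sub>v (dim_row A)"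
    proof
      assume "vec N (\<lambda>i. x (vs ! i)) = 0\<^sub>v (dim_row A)"
      hence "vec N (\<lambda>i. x (vs ! i)) $ i = 0\<^sub>v (dim_row A) $ i" by simp
      thus False using i v A by simp
    qed
    show "A *\<^sub>v vec N (\<lambda>i. x (vs ! i)) = m \<cdot>\<^sub>v vec N (\<lambda>i. x (vs ! i))"
    proof (rule eq_vecI)
      fix i assume "i < dim_vec (m \<cdot>\<^sub>v vec N (\<lambda>i. x (vs ! i)))"
      hence i: "i < N" by simp
      hence "vs ! i \<in> pverts G" using nth_mem[of i vs] unfolding N_def vs(2) by blast
      from x(3)[OF this] have "(\<Sum>j = 0..<N. adj G (vs ! i) (vs ! j) * x (vs ! j)) = m * x (vs ! i)"
        unfolding reindex .
      thus "(A *\<^sub>v vec N (\<lambda>i. x (vs ! i))) $ i = (m \<cdot>\<^sub>v vec N (\<lambda>i. x (vs ! i))) $ i"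
        using i by (simp add: Av)
    qed (use A in simp)
  qed
  hence "eigenvalue A m" unfolding eigenvalue_def by blast
  hence "Max (spectrum A) = m"
    using card_finite_spectrum(1)[OF A] le by (intro Max_eqI) (auto simp: spectrum_def)
  hence "lambda1 G = m" by (simp add: lambda1_def A_def vs_def)
  thus ?thesis using that[of x] x by simp
qed

lemma lambda1_eigenvector:
  assumes "finite (pverts G)" "pverts G \<noteq> {}" "sym (parcs G)"
  shows "\<exists>x. (\<forall>v. 0 \<le> x v) \<and> (\<exists>v\<in>pverts G. x v \<noteq> 0) \<and>
    (\<forall>u\<in>pverts G. (\<Sum>v\<in>pverts G. adj G u v * x v) = lambda1 G * x u)"
  by (rule lambda1_rayleigh[OF assms]) blast

lemma quad_form_le_lambda1:
  assumes "finite (pverts G)" "pverts G \<noteq> {}" "sym (parcs G)"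
  shows "quad_form (pverts G) (adj G) z \<le> lambda1 G * (\<Sum>v\<in>pverts G. (z v)\<^sup>2)"
  by (rule lambda1_rayleigh[OF assms]) blast

lemma lambda1_le_if_embedded:
  assumes G: "finite (pverts G)" "pverts G \<noteq> {}" "sym (parcs G)"
    and H: "finite (pverts H)" "sym (parcs H)"
    and f: "bij_betw f (pverts G) (pverts H)"
    and iso: "\<And>u v. u \<in> pverts G \<Longrightarrow> v \<in> pverts G \<Longrightarrow> (u, v) \<in> parcs G \<longleftrightarrow> (f u, f v) \<in> parcs H"
  shows "lambda1 G \<le> lambda1 H"
proof -
  obtain x where x: "\<exists>v\<in>pverts G. x v \<noteq> 0"
    "\<And>u. u \<in> pverts G \<Longrightarrow> (\<Sum>v\<in>pverts G. adj G u v * x v) = lambda1 G * x u"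
    using lambda1_eigenvector[OF G] by blast
  have "pverts H \<noteq> {}" using f G(2) by (auto simp: bij_betw_def)
  then have H_le: "quad_form (pverts H) (adj H) z \<le> lambda1 H * (\<Sum>v\<in>pverts H. (z v)\<^sup>2)" for z
    by (rule quad_form_le_lambda1[OF H(1) _ H(2)])
  define z where "z v = x (the_inv_into (pverts G) f v)" for v
  have z: "z (f v) = x v" if "v \<in> pverts G" for v
    using the_inv_into_f_f[OF bij_betw_imp_inj_on[OF f] that] by (simp add: z_def)
  have sq: "(\<Sum>v\<in>pverts H. (z v)\<^sup>2) = (\<Sum>v\<in>pverts G. (x v)\<^sup>2)"
    unfolding sum.reindex_bij_betw[OF f, symmetric] by (intro sum.cong) (auto simp: z)
  have "lambda1 G * (\<Sum>v\<in>pverts G. (x v)\<^sup>2) = (\<Sum>u\<in>pverts G. (\<Sum>v\<in>pverts G. adj G u v * x v) * x u)"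
    unfolding sum_distrib_left by (intro sum.cong) (auto simp: x power2_eq_square)
  also have "\<dots> = quad_form (pverts G) (adj G) x"
    unfolding quad_form_def sum_distrib_right by (intro sum.cong) (auto simp: mult_ac)
  also have "\<dots> = quad_form (pverts H) (adj H) z"
    unfolding quad_form_def sum.reindex_bij_betw[OF f, symmetric]
    by (intro sum.cong) (auto simp: z iso adj_def)
  also have "\<dots> \<le> lambda1 H * (\<Sum>v\<in>pverts G. (x v)\<^sup>2)" using H_le[of z] by (simp add: sq)
  finally have "lambda1 G * (\<Sum>v\<in>pverts G. (x v)\<^sup>2) \<le> lambda1 H * (\<Sum>v\<in>pverts G. (x v)\<^sup>2)" .
  moreover have "0 < (\<Sum>v\<in>pverts G. (x v)\<^sup>2)"
    using x(1) G(1) by (auto intro: sum_pos2)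
  ultimately show ?thesis by simp
qed

lemma lambda1_eq_if_isomorphic:
  assumes G: "finite (pverts G)" "pverts G \<noteq> {}" "sym (parcs G)"
    and H: "finite (pverts H)" "sym (parcs H)"
    and f: "bij_betw f (pverts G) (pverts H)"
    and iso: "\<And>u v. u \<in> pverts G \<Longrightarrow> v \<in> pverts G \<Longrightarrow> (u, v) \<in> parcs G \<longleftrightarrow> (f u, f v) \<in> parcs H"
  shows "lambda1 G = lambda1 H"
proof (rule antisym)
  show "lambda1 G \<le> lambda1 H" by (rule lambda1_le_if_embedded[OF assms])
  let ?g = "the_inv_into (pverts G) f"
  have g: "bij_betw ?g (pverts H) (pverts G)" using f by (rule bij_betw_the_inv_into)
  have fg: "f (?g u) = u" if "u \<in> pverts H" for u
    using f_the_inv_into_f_bij_betw[OF f] that by simp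
  show "lambda1 H \<le> lambda1 G"
  proof (rule lambda1_le_if_embedded[OF H(1) _ H(2) G(1,3) g])
    show "pverts H \<noteq> {}" using f G(2) by (auto simp: bij_betw_def)
    show "(u, v) \<in> parcs H \<longleftrightarrow> (?g u, ?g v) \<in> parcs G" if "u \<in> pverts H" "v \<in> pverts H" for u v
      using iso[of "?g u" "?g v"] bij_betwE[OF g] that by (simp add: fg)
  qed
qed

text \<open>\<open>digraph_iso\<close> also carries maps for arcs, heads and tails. Since both
  graphs have \<open>fst\<close> and \<open>snd\<close> as tail and head, the arc map is determined
  by the vertex map.\<close>

lemma digraph_iso_with_proj_iff:
  assumes G: "pair_wf_digraph G" and H: "pair_wf_digraph H"
  shows "digraph_iso (with_proj G) (with_proj H) \<longleftrightarrow>
    (\<exists>f. bij_betw f (pverts G) (pverts H) \<and>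
      (\<forall>u\<in>pverts G. \<forall>v\<in>pverts G. (u, v) \<in> parcs G \<longleftrightarrow> (f u, f v) \<in> parcs H))" (is "?L \<longleftrightarrow> ?R")
proof
  assume ?L
  then obtain h where h: "pre_digraph.digraph_isomorphism (with_proj G) h"
    and eq: "with_proj H = app_iso h (with_proj G)"
    unfolding digraph_iso_def by blast
  let ?f = "iso_verts h"
  have V: "pverts H = ?f ` pverts G" using arg_cong[OF eq, of verts] by simp
  have tl: "iso_tail h = fst" using arg_cong[OF eq, of tail] by simp
  have hd: "iso_head h = snd" using arg_cong[OF eq, of head] by simp
  have inj: "inj_on ?f (pverts G)" using h by (simp add: pre_digraph.digraph_isomorphism_def)
  have arc: "iso_arcs h a = (?f (fst a), ?f (snd a))" if "a \<in> parcs G" for a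
    using h that tl hd by (simp add: pre_digraph.digraph_isomorphism_def prod_eq_iff)
  have P: "parcs H = (\<lambda>a. (?f (fst a), ?f (snd a))) ` parcs G"
    using arg_cong[OF eq, of arcs] arc by (simp cong: image_cong)
  have "(u, v) \<in> parcs G" if uv: "u \<in> pverts G" "v \<in> pverts G" "(?f u, ?f v) \<in> parcs H" for u v
  proof -
    obtain a where a: "a \<in> parcs G" "?f u = ?f (fst a)" "?f v = ?f (snd a)" using uv(3) P by auto
    hence "fst a \<in> pverts G" "snd a \<in> pverts G"
      using pair_wf_digraph.arc_fst_in_verts[OF G] pair_wf_digraph.arc_snd_in_verts[OF G] by auto
    hence "u = fst a" "v = snd a" using a(2,3) uv(1,2) inj by (blast dest: inj_onD)+
    thus ?thesis using a(1) by simp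
  qed
  moreover have "(?f u, ?f v) \<in> parcs H" if "(u, v) \<in> parcs G" for u v
    using that unfolding P by (intro image_eqI[where x = "(u, v)"]) auto
  ultimately show ?R using V inj by (intro exI[of _ ?f]) (auto simp: bij_betw_def)
next
  assume ?R
  then obtain f where f: "bij_betw f (pverts G) (pverts H)"
    and iso: "\<And>u v. u \<in> pverts G \<Longrightarrow> v \<in> pverts G \<Longrightarrow> (u, v) \<in> parcs G \<longleftrightarrow> (f u, f v) \<in> parcs H" by blast
  have wf: "fst a \<in> pverts G" "snd a \<in> pverts G" if "a \<in> parcs G" for a
    using that pair_wf_digraph.arc_fst_in_verts[OF G] pair_wf_digraph.arc_snd_in_verts[OF G] by auto
  have wfH: "fst a \<in> pverts H" "snd a \<in> pverts H" if "a \<in> parcs H" for a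
    using that pair_wf_digraph.arc_fst_in_verts[OF H] pair_wf_digraph.arc_snd_in_verts[OF H] by auto
  define h where "h = \<lparr>iso_verts = f, iso_arcs = map_prod f f, iso_head = snd, iso_tail = fst\<rparr>"
  have inj: "inj_on f (pverts G)" using f by (rule bij_betw_imp_inj_on)
  have "inj_on (map_prod f f) (parcs G)"
  proof (rule inj_onI)
    fix a b assume "a \<in> parcs G" "b \<in> parcs G" "map_prod f f a = map_prod f f b"
    thus "a = b" using wf[of a] wf[of b] inj by (cases a; cases b) (auto dest: inj_onD)
  qed
  hence "pre_digraph.digraph_isomorphism (with_proj G) h"
    using inj G by (simp add: pre_digraph.digraph_isomorphism_def h_def wf_digraph_wp_iff)
  moreover have "map_prod f f ` parcs G = parcs H"
  proof
    show "map_prod f f ` parcs G \<subseteq> parcs H"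
    proof
      fix a assume "a \<in> map_prod f f ` parcs G"
      then obtain b where b: "b \<in> parcs G" "a = (f (fst b), f (snd b))"
        by (auto simp: map_prod_def split_beta)
      thus "a \<in> parcs H" using iso[of "fst b" "snd b"] wf[OF b(1)] by simp
    qed
    show "parcs H \<subseteq> map_prod f f ` parcs G"
    proof
      fix a assume a: "a \<in> parcs H"
      obtain u v where uv: "u \<in> pverts G" "v \<in> pverts G" "f u = fst a" "f v = snd a"
        using wfH[OF a] bij_betw_imp_surj_on[OF f] by (metis imageE)
      hence "(u, v) \<in> parcs G" using iso[of u v] a by simp
      thus "a \<in> map_prod f f ` parcs G" using uv by (intro image_eqI[where x = "(u, v)"]) auto
    qed
  qed
  hence "with_proj H = app_iso h (with_proj G)"
    using bij_betw_imp_surj_on[OF f] by (simp add: app_iso_def with_proj_def h_def)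
  ultimately show ?L unfolding digraph_iso_def by blast
qed

section \<open>The graphs B n\<close>

interpretation B: ladder_cap "\<lambda>i. i < 3" 0 3
proof
  have "{i::nat. i < 6 \<and> i < 3} = {..<3}" by auto
  thus "card {i::nat. i < 6 \<and> i < 3} = 3" by simp
qed auto

definition ladder_graph :: "nat \<Rightarrow> nat pair_pre_digraph" where
  "ladder_graph n = \<lparr>pverts = {..<n}, parcs = {(i, j). i < n \<and> j < n \<and> B.L i j}\<rparr>"

lemma pverts_ladder_graph: "pverts (ladder_graph n) = {..<n}"
  by (simp add: ladder_graph_def)

lemma degree_ladder_graph:
  assumes "v < n"
  shows "degree_of (ladder_graph n) v = nbrs B.L v n"
proof -
  have "out_arcs (with_proj (ladder_graph n)) v = Pair v ` {j. j < n \<and> B.L v j}"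
    using assms by (auto simp: out_arcs_def ladder_graph_def)
  moreover have "inj_on (Pair v) {j. j < n \<and> B.L v j}" by (auto simp: inj_on_def)
  ultimately show ?thesis by (simp add: out_degree_def nbrs_card card_image)
qed

lemma nbrs_B_ge_3:
  assumes "v + 2 < n" "8 \<le> n"
  shows "3 \<le> nbrs B.L v n"
proof (cases "v < 6")
  case True
  have "B.L v 6 \<longleftrightarrow> v = 0" "B.L v 7 \<longleftrightarrow> v = 3" using True by (auto simp: ladder_def down_def)
  moreover have "nbrs B.L v 8 = nbrs B.L v 6 + of_bool (B.L v 6) + of_bool (B.L v 7)"
    by (simp add: nbrs_numeral)
  ultimately have "nbrs B.L v 8 = 3" using B.nbrs_top[OF True] by simp
  thus ?thesis using nbrs_mono[of 8 n B.L v] assms by simp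
next
  case False
  hence v: "6 \<le> v" by simp
  have "B.L v (Suc v) \<longleftrightarrow> even v" "B.L v (Suc (Suc v))" using v by (auto simp: ladder_def down_def)
  hence "nbrs B.L v (Suc (Suc (Suc v))) = 3" using B.nbrs_down[OF v] B.not_ladder_diag[of v] by simp
  thus ?thesis using nbrs_mono[of "Suc (Suc (Suc v))" n B.L v] assms by simp
qed

text \<open>For \<open>n = 7\<close> the pair is not the last two vertices because
  \<open>q = 3\<close> still waits for vertex 7. From 8 on the cap is saturated and only the last
  two vertices are deficient.\<close>

lemma unsaturated_ladder_graph:
  assumes "6 \<le> n"
  shows "unsaturated (ladder_graph n) = (if n = 6 then {0, 3} else if n = 7 then {3, 6} else {n - 2, n - 1})"
proof -
  have unsat: "unsaturated (ladder_graph n) = {v. v < n \<and> nbrs B.L v n < 3}"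
    unfolding unsaturated_def using degree_ladder_graph by (auto simp: pverts_ladder_graph)
  consider "n = 6" | "n = 7" | "8 \<le> n" using assms by linarith
  thus ?thesis
  proof cases
    case 1
    have "nbrs B.L v 6 < 3 \<longleftrightarrow> v = 0 \<or> v = 3" if "v < 6" for v
      using B.nbrs_top[OF that] by (cases "v = 0"; cases "v = 3"; simp)
    thus ?thesis unfolding unsat using 1 by auto
  next
    case 2
    have "nbrs B.L v 7 < 3 \<longleftrightarrow> v = 3" if "v < 6" for v
    proof -
      have "B.L v 6 \<longleftrightarrow> v = 0" using that by (auto simp: ladder_def down_def)
      moreover have "nbrs B.L v 7 = nbrs B.L v 6 + of_bool (B.L v 6)" by (simp add: nbrs_numeral)
      ultimately show ?thesis using B.nbrs_top[OF that] by (cases "v = 0"; cases "v = 3"; simp)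
    qed
    moreover have "nbrs B.L 6 7 < 3"
      using B.nbrs_down[of 6] B.not_ladder_diag[of 6] nbrs_Suc[of B.L 6 6] by simp
    moreover have "v < 7 \<longleftrightarrow> v < 6 \<or> v = 6" for v :: nat by linarith
    ultimately show ?thesis unfolding unsat using 2 by auto
  next
    case 3
    obtain m where m: "n = Suc (Suc m)" "6 \<le> m" using 3 by (intro that[of "n - 2"]) auto
    have "nbrs B.L (Suc m) n < 3"
      using B.nbrs_down[of "Suc m"] B.not_ladder_diag[of "Suc m"] m by simp
    moreover have "nbrs B.L m n < 3"
    proof -
      have "B.L m (Suc m) \<longleftrightarrow> even m" using m by (auto simp: ladder_def down_def)
      thus ?thesis using B.nbrs_down[of m] B.not_ladder_diag[of m] m by simp
    qed
    moreover have "\<not> nbrs B.L v n < 3" if "v < m" for v using nbrs_B_ge_3[of v n] that 3 m by simp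
    moreover have "v < n \<longleftrightarrow> v < m \<or> v = m \<or> v = Suc m" for v using m by auto
    ultimately have "{v. v < n \<and> nbrs B.L v n < 3} = {m, Suc m}" by auto
    thus ?thesis unfolding unsat using 3 m by simp
  qed
qed

lemma join_vertex_ladder_graph:
  assumes "\<And>j. j < n \<Longrightarrow> B.L n j \<longleftrightarrow> j \<in> S" "S \<subseteq> {..<n}"
  shows "join_vertex n S (ladder_graph n) = ladder_graph (Suc n)"
proof -
  have "B.L j n \<longleftrightarrow> j \<in> S" if "j < n" for j using assms(1)[OF that] ladder_sym by blast
  moreover have "\<not> B.L n n" by (rule B.not_ladder_diag)
  ultimately show ?thesis using assms
    unfolding join_vertex_def ladder_graph_def by (auto simp: less_Suc_eq subset_eq)
qed

text \<open>The equality is literal: \<open>Min\<close> selects \<open>p = 0\<close> at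
  \<open>n = 6\<close> and \<open>n - 2\<close> at later even \<open>n\<close>, which is the vertex
  that \<open>down\<close> joins to the new one.\<close>

lemma B_eq_ladder_graph:
  assumes "6 \<le> n"
  shows "B n = ladder_graph n"
  using assms
proof (induction n rule: dec_induct)
  case base
  have "B.L i j \<longleftrightarrow> (i < 3) \<noteq> (j < 3) \<and> {i, j} \<noteq> {0, 3}" if "i < 6" "j < 6" for i j
    using B.top_iff[OF that] .
  hence "parcs B6 = {(i, j). i < 6 \<and> j < 6 \<and> B.L i j}"
    by (auto simp: B6_def K33_def doubleton_eq_iff)
  thus ?case by (simp add: B.simps ladder_graph_def) (simp add: B6_def K33_def)
next
  case (step n)
  have Suc: "B (Suc n) = (if odd (Suc n) then join_vertex n {Min (unsaturated (B n))} (B n)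
      else join_vertex n (unsaturated (B n)) (B n))"
    using step.hyps by (subst B.simps) simp
  consider "n = 6" | "n = 7" | "8 \<le> n" "even n" | "8 \<le> n" "odd n" using step.hyps by linarith
  thus ?case
  proof cases
    case 1
    have "B (Suc n) = join_vertex n {0} (ladder_graph n)"
      unfolding Suc step.IH unsaturated_ladder_graph[OF step.hyps(1)] using 1 by simp
    also have "\<dots> = ladder_graph (Suc n)"
      by (rule join_vertex_ladder_graph) (use 1 in \<open>auto simp: B.ladder_down_iff down_def\<close>)
    finally show ?thesis .
  next
    case 2
    have "B (Suc n) = join_vertex n {3, 6} (ladder_graph n)"
      unfolding Suc step.IH unsaturated_ladder_graph[OF step.hyps(1)] using 2 by simp
    also have "\<dots> = ladder_graph (Suc n)"
      by (rule join_vertex_ladder_graph) (use 2 in \<open>auto simp: B.ladder_down_iff down_def\<close>)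
    finally show ?thesis .
  next
    case 3
    have "Min {n - 2, n - 1} = n - 2" by simp
    hence "B (Suc n) = join_vertex n {n - 2} (ladder_graph n)"
      unfolding Suc step.IH unsaturated_ladder_graph[OF step.hyps(1)] using 3 by simp
    also have "\<dots> = ladder_graph (Suc n)"
      by (rule join_vertex_ladder_graph) (use 3 in \<open>auto simp: B.ladder_down_iff down_def\<close>)
    finally show ?thesis .
  next
    case 4
    have "n \<noteq> 6" "n \<noteq> 7" using 4 by auto
    hence "B (Suc n) = join_vertex n {n - 2, n - 1} (ladder_graph n)"
      unfolding Suc step.IH unsaturated_ladder_graph[OF step.hyps(1)] using 4 by simp
    also have "\<dots> = ladder_graph (Suc n)"
      by (rule join_vertex_ladder_graph) (use 4 in \<open>auto simp: B.ladder_down_iff down_def\<close>)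
    finally show ?thesis .
  qed
qed

section \<open>From graphs to numbered graphs\<close>

lemma ex_decreasing_enumeration:
  fixes x :: "'a \<Rightarrow> real"
  assumes "finite V"
  obtains e where "bij_betw e {..<card V} V" "\<And>i j. i \<le> j \<Longrightarrow> j < card V \<Longrightarrow> x (e j) \<le> x (e i)"
proof -
  obtain l where l: "set l = V" "distinct l" using finite_distinct_list[OF assms] by blast
  define s where "s = sort_key (\<lambda>v. - x v) l"
  have s: "set s = V" "distinct s" "length s = card V" using l by (auto simp: s_def distinct_card[symmetric])
  have "sorted (map (\<lambda>v. - x v) s)" unfolding s_def by simp
  hence "x (s ! j) \<le> x (s ! i)" if "i \<le> j" "j < card V" for i j
    using that s(3) sorted_nth_mono[of "map (\<lambda>v. - x v) s" i j] by simp
  moreover have "bij_betw (\<lambda>i. s ! i) {..<card V} V"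
    by (rule bij_betw_nth[OF s(2)]) (use s in auto)
  ultimately show ?thesis by (intro that[of "\<lambda>i. s ! i"]) auto
qed

lemma connected_cut:
  assumes G: "pair_graph G" and conn: "Digraph_Component.connected (with_proj G)"
    and S: "S \<subset> pverts G" "S \<noteq> {}"
  obtains u v where "(u, v) \<in> parcs G" "u \<in> S" "v \<in> pverts G - S"
proof -
  interpret pair_graph G by (rule G)
  obtain u v where uv: "u \<in> S" "v \<in> pverts G" "v \<notin> S" using S by blast
  have "strongly_connected (with_proj G)"
    using symmetric_connected_imp_strongly_connected[OF _ conn] sym_arcs by simp
  hence "u \<rightarrow>\<^sup>*\<^bsub>with_proj G\<^esub> v" using uv S by (auto simp: strongly_connected_def)
  hence "v \<in> S \<or> (\<exists>a b. (a, b) \<in> parcs G \<and> a \<in> S \<and> b \<in> pverts G - S)"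
  proof (induction rule: reachable_induct)
    case base
    thus ?case using uv by blast
  next
    case (step a b)
    thus ?case using arc_snd_in_verts[of "(a, b)"] by auto
  qed
  thus ?thesis using that uv(3) by blast
qed

lemma sum_nbr_sum_mult:
  "(\<Sum>i<n. nbr_sum n E x i * x i) = quad_form {..<n} (\<lambda>i j. of_bool (E i j)) x"
  unfolding quad_form_def nbr_sum_def sum_distrib_right by (intro sum.cong) (auto simp: mult_ac)

text \<open>Differently numbered caps give isomorphic ladders, so the single number
  \<open>lambda1 (B n)\<close> bounds the forms of all of them.\<close>

lemma ladder_form_le:
  assumes cap: "ladder_cap c p q" and n: "6 \<le> n"
  shows "quad_form {..<n} (\<lambda>i j. of_bool (ladder c p q i j)) z \<le> lambda1 (B n) * (\<Sum>i<n. (z i)\<^sup>2)"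
proof -
  obtain g where g: "bij_betw g {..<n} {..<n}"
    and iso: "\<And>i j. B.L i j \<longleftrightarrow> ladder c p q (g i) (g j)"
    using B.isomorphic[OF cap n] by blast
  have Bn: "pverts (B n) = {..<n}" "\<And>i j. i < n \<Longrightarrow> j < n \<Longrightarrow> adj (B n) i j = of_bool (B.L i j)"
    using n by (simp_all add: B_eq_ladder_graph ladder_graph_def adj_def)
  have fin: "finite (pverts (B n))" "pverts (B n) \<noteq> {}" using n by (auto simp: Bn(1) lessThan_empty_iff)
  have symB: "sym (parcs (B n))"
    using n ladder_sym by (auto simp: B_eq_ladder_graph ladder_graph_def sym_def)
  have le: "quad_form (pverts (B n)) (adj (B n)) y \<le> lambda1 (B n) * (\<Sum>v\<in>pverts (B n). (y v)\<^sup>2)" for y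
    by (rule quad_form_le_lambda1[OF fin symB])
  have "quad_form {..<n} (\<lambda>i j. of_bool (ladder c p q i j)) z
      = (\<Sum>i<n. \<Sum>j<n. of_bool (ladder c p q (g i) (g j)) * z (g i) * z (g j))"
    unfolding quad_form_def
    by (rule trans[OF sum.reindex_bij_betw[OF g, symmetric] sum.cong[OF refl sum.reindex_bij_betw[OF g, symmetric]]])
  also have "\<dots> = quad_form (pverts (B n)) (adj (B n)) (z \<circ> g)"
    unfolding quad_form_def Bn(1) by (intro sum.cong) (auto simp: Bn(2) iso)
  also have "\<dots> \<le> lambda1 (B n) * (\<Sum>i<n. (z (g i))\<^sup>2)" using le[of "z \<circ> g"] by (simp add: Bn(1))
  also have "(\<Sum>i<n. (z (g i))\<^sup>2) = (\<Sum>i<n. (z i)\<^sup>2)" by (rule sum.reindex_bij_betw[OF g])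
  finally show ?thesis .
qed

lemma ordered_subcubic_enumeration:
  fixes G :: "'a pair_pre_digraph"
  assumes G: "connected_subcubic_bipartite G" and n: "card (pverts G) = n"
    and e: "bij_betw e {..<n} (pverts G)"
  obtains \<gamma> where "ordered_subcubic n (\<lambda>i j. i < n \<and> j < n \<and> (e i, e j) \<in> parcs G) \<gamma>"
proof -
  have pg: "pair_graph G" and conn: "Digraph_Component.connected (with_proj G)"
    and irr: "irregular G" and "bipartite G" and md: "max_degree G = 3"
    using G by (auto simp: connected_subcubic_bipartite_def)
  interpret pair_graph G by (rule pg)
  obtain U W where U: "pverts G = U \<union> W" "U \<inter> W = {}" "parcs G \<subseteq> U \<times> W \<union> W \<times> U"
    using \<open>bipartite G\<close> unfolding bipartite_def by blast
  define E where "E = (\<lambda>i j. i < n \<and> j < n \<and> (e i, e j) \<in> parcs G)"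
  have inj: "inj_on e {..<n}" using e by (rule bij_betw_imp_inj_on)
  have img: "e ` {..<n} = pverts G" using e by (rule bij_betw_imp_surj_on)
  have deg: "nbrs E i n = degree_of G (e i)" if "i < n" for i
  proof -
    have "out_arcs (with_proj G) (e i) = (\<lambda>j. (e i, e j)) ` {j. j < n \<and> E i j}"
    proof
      show "(\<lambda>j. (e i, e j)) ` {j. j < n \<and> E i j} \<subseteq> out_arcs (with_proj G) (e i)"
        by (auto simp: out_arcs_def E_def)
      show "out_arcs (with_proj G) (e i) \<subseteq> (\<lambda>j. (e i, e j)) ` {j. j < n \<and> E i j}"
      proof
        fix a assume "a \<in> out_arcs (with_proj G) (e i)"
        hence a: "a \<in> parcs G" "fst a = e i" by (auto simp: out_arcs_def)
        then obtain j where j: "j < n" "snd a = e j"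
          using arc_snd_in_verts[OF a(1)] img by (metis imageE lessThan_iff)
        hence "E i j" using a that by (metis E_def prod.collapse)
        thus "a \<in> (\<lambda>j. (e i, e j)) ` {j. j < n \<and> E i j}"
          using a j by (intro image_eqI[where x = j]) (auto simp: prod_eq_iff)
      qed
    qed
    moreover have "inj_on (\<lambda>j. (e i, e j)) {j. j < n \<and> E i j}"
      using inj by (auto simp: inj_on_def)
    ultimately show ?thesis by (simp add: out_degree_def nbrs_card card_image)
  qed
  have deg3: "degree_of G v \<le> 3" if "v \<in> pverts G" for v
  proof -
    have "degree_of G v \<le> Max (degree_of G ` pverts G)"
      by (rule Max_ge) (use pair_finite_verts that in auto)
    thus ?thesis using md by (simp add: max_degree_def)
  qed
  have "ordered_subcubic n E (\<lambda>i. e i \<in> U)"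
  proof
    show "E j i" if "E i j" for i j
      using that sym_arcs by (auto simp: E_def symmetric_def dest: symD)
    show "(e i \<in> U) \<noteq> (e j \<in> U)" if "E i j" for i j
      using that U by (auto simp: E_def)
    show "j < n" if "E i j" for i j using that by (simp add: E_def)
    show "nbrs E i n \<le> 3" for i
    proof (cases "i < n")
      case True
      thus ?thesis using deg3[of "e i"] img by (auto simp: deg)
    next
      case False
      thus ?thesis by (simp add: nbrs_card E_def)
    qed
    show "\<exists>i<n. nbrs E i n < 3"
    proof (rule ccontr)
      assume "\<not> (\<exists>i<n. nbrs E i n < 3)"
      hence "degree_of G (e i) = 3" if "i < n" for i
        using deg[OF that] deg3[of "e i"] img that by (metis image_eqI lessThan_iff nat_less_le not_less)
      hence "\<forall>v\<in>pverts G. degree_of G v = 3" unfolding img[symmetric] by auto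
      thus False using irr unfolding irregular_def by blast
    qed
    show "\<exists>i<k. \<exists>j\<ge>k. E i j" if k: "0 < k" "k < n" for k
    proof -
      have "e ` {..<k} \<subset> pverts G"
      proof
        show "e ` {..<k} \<subseteq> pverts G" using k img by auto
        have "e k \<noteq> e i" if "i < k" for i
          using inj_onD[OF inj, of k i] that k by auto
        hence "e k \<notin> e ` {..<k}" by auto
        moreover have "e k \<in> pverts G" using k img by auto
        ultimately show "e ` {..<k} \<noteq> pverts G" by blast
      qed
      moreover have "e ` {..<k} \<noteq> {}" using k by (auto simp: lessThan_empty_iff)
      ultimately obtain u v where uv: "(u, v) \<in> parcs G" "u \<in> e ` {..<k}" "v \<in> pverts G - e ` {..<k}"
        using connected_cut[OF pg conn] by metis
      obtain i where i: "i < k" "u = e i" using uv(2) by auto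
      obtain j where j: "j < n" "v = e j" using uv(3) img by auto
      have "k \<le> j" using uv(3) j by (auto simp: not_less[symmetric])
      have "E i j" using i j uv(1) k by (simp add: E_def)
      thus ?thesis using i(1) \<open>k \<le> j\<close> by blast
    qed
  qed
  thus ?thesis using that unfolding E_def by blast
qed

theorem theorem1p2:
  fixes G :: "'a pair_pre_digraph" and n :: nat
  assumes "n \<ge> 6"
    and "connected_subcubic_bipartite G"
    and "card (pverts G) = n"
  shows "lambda1 G \<le> lambda1 (B n) \<and>
    (lambda1 G = lambda1 (B n) \<longleftrightarrow> digraph_iso (with_proj G) (with_proj (B n)))"
proof -
  have pg: "pair_graph G" using assms(2) by (simp add: connected_subcubic_bipartite_def)
  interpret pair_graph G by (rule pg)
  have fin: "finite (pverts G)" by (rule pair_finite_verts)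
  have ne: "pverts G \<noteq> {}" using assms by auto
  have symG: "sym (parcs G)" using sym_arcs by (simp add: symmetric_def)
  have pvB: "pverts (B n) = {..<n}" using assms(1) by (simp add: B_eq_ladder_graph ladder_graph_def)
  have arcB: "(i, j) \<in> parcs (B n) \<longleftrightarrow> i < n \<and> j < n \<and> B.L i j" for i j
    using assms(1) by (simp add: B_eq_ladder_graph ladder_graph_def)
  have symB: "sym (parcs (B n))" using ladder_sym by (auto simp: sym_def arcB)
  have wfB: "pair_wf_digraph (B n)" by unfold_locales (auto simp: arcB pvB)
  obtain x where x: "\<And>v. 0 \<le> x v" "\<exists>v\<in>pverts G. x v \<noteq> 0"
    "\<And>u. u \<in> pverts G \<Longrightarrow> (\<Sum>v\<in>pverts G. adj G u v * x v) = lambda1 G * x u"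
    using lambda1_eigenvector[OF fin ne symG] by blast
  obtain e where e: "bij_betw e {..<n} (pverts G)"
    and decr_e: "\<And>i j. i \<le> j \<Longrightarrow> j < n \<Longrightarrow> x (e j) \<le> x (e i)"
    using ex_decreasing_enumeration[OF fin, of x] assms(3) by metis
  define E where "E = (\<lambda>i j. i < n \<and> j < n \<and> (e i, e j) \<in> parcs G)"
  \<comment> \<open>The value 0 from \<open>n\<close> on keeps \<open>y\<close> decreasing and makes
    its last entry the final gap of the summation by parts.\<close>
  define y where "y i = (if i < n then x (e i) else 0)" for i
  obtain \<gamma> where "ordered_subcubic n E \<gamma>"
    using ordered_subcubic_enumeration[OF assms(2,3) e] unfolding E_def by blast
  then interpret E: ordered_subcubic n E \<gamma> .
  have img: "e i \<in> pverts G" if "i < n" for i using bij_betwE[OF e] that by simp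
  have eigen: "nbr_sum n E y i = lambda1 G * y i" if "i < n" for i
  proof -
    have "nbr_sum n E y i = (\<Sum>j<n. adj G (e i) (e j) * x (e j))"
      unfolding nbr_sum_def using that by (intro sum.cong) (auto simp: y_def E_def adj_def)
    also have "\<dots> = (\<Sum>v\<in>pverts G. adj G (e i) v * x v)" by (rule sum.reindex_bij_betw[OF e])
    finally show ?thesis using x(3)[OF img[OF that]] that by (simp add: y_def)
  qed
  have decr: "y j \<le> y i" if "i \<le> j" for i j
    using decr_e[OF that] x(1) that by (auto simp: y_def)
  have zero: "y i = 0" if "n \<le> i" for i using that by (simp add: y_def)
  have nz: "\<exists>i<n. y i \<noteq> 0"
  proof -
    obtain v where v: "v \<in> pverts G" "x v \<noteq> 0" using x(2) by blast
    then obtain i where "i < n" "v = e i" using bij_betw_imp_surj_on[OF e] by blast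
    thus ?thesis using v(2) by (auto simp: y_def)
  qed
  define Y where "Y = (\<Sum>i<n. (y i)\<^sup>2)"
  have "0 < Y" unfolding Y_def using nz by (auto intro: sum_pos2)
  obtain c w where cap: "ladder_cap c w 5"
    and le: "lambda1 G * Y \<le> (\<Sum>i<n. nbr_sum n (ladder c w 5) y i * y i)"
    and iso: "(\<forall>i<n. nbr_sum n (ladder c w 5) y i = lambda1 G * y i) \<longrightarrow>
      (\<forall>c' p' q'. ladder_cap c' p' q' \<longrightarrow>
        (\<exists>f. bij_betw f {..<n} {..<n} \<and> (\<forall>i<n. \<forall>j<n. E i j \<longleftrightarrow> ladder c' p' q' (f i) (f j))))"
    using E.dominating_ladder[OF assms(1) eigen decr zero nz] unfolding Y_def by blast
  have bound: "quad_form {..<n} (\<lambda>i j. of_bool (ladder c w 5 i j)) z \<le> lambda1 (B n) * (\<Sum>i<n. (z i)\<^sup>2)" for z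
    by (rule ladder_form_le[OF cap assms(1)])
  have "lambda1 G * Y \<le> lambda1 (B n) * Y"
    using le bound[of y] unfolding sum_nbr_sum_mult Y_def by linarith
  hence main: "lambda1 G \<le> lambda1 (B n)" using \<open>0 < Y\<close> by simp
  have "digraph_iso (with_proj G) (with_proj (B n))" if eq: "lambda1 G = lambda1 (B n)"
  proof -
    \<comment> \<open>Equality of the spectral radii closes the chain of inequalities, so the Perron
      vector of G maximises the ladder's Rayleigh quotient and is an eigenvector there as
      well.\<close>
    have att: "quad_form {..<n} (\<lambda>i j. of_bool (ladder c w 5 i j)) y = lambda1 (B n) * (\<Sum>i<n. (y i)\<^sup>2)"
      using le bound[of y] eq unfolding sum_nbr_sum_mult Y_def by simp
    have "nbr_sum n (ladder c w 5) y i = lambda1 G * y i" if "i < n" for i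
      unfolding nbr_sum_def eq
      by (rule quad_form_maximiser_eigenvector[OF _ _ bound att]) (use that ladder_sym in auto)
    then obtain f where f: "bij_betw f {..<n} {..<n}"
      "\<And>i j. i < n \<Longrightarrow> j < n \<Longrightarrow> E i j \<longleftrightarrow> B.L (f i) (f j)"
      using iso B.ladder_cap_axioms by blast
    let ?g = "the_inv_into {..<n} e"
    have g: "bij_betw ?g (pverts G) {..<n}" using e by (rule bij_betw_the_inv_into)
    have eg: "e (?g u) = u" if "u \<in> pverts G" for u
      using f_the_inv_into_f_bij_betw[OF e] that by simp
    have "(u, v) \<in> parcs G \<longleftrightarrow> (f (?g u), f (?g v)) \<in> parcs (B n)"
      if uv: "u \<in> pverts G" "v \<in> pverts G" for u v
    proof -
      have "?g u < n" "?g v < n" using bij_betwE[OF g] uv by auto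
      moreover from this have "f (?g u) < n" "f (?g v) < n" using bij_betwE[OF f(1)] by auto
      ultimately show ?thesis using f(2)[of "?g u" "?g v"] by (simp add: E_def eg uv arcB)
    qed
    moreover have "bij_betw (f \<circ> ?g) (pverts G) (pverts (B n))"
      unfolding pvB by (rule bij_betw_trans[OF g f(1)])
    ultimately show ?thesis
      unfolding digraph_iso_with_proj_iff[OF pair_wf_digraph_axioms wfB]
      by (intro exI[of _ "f \<circ> ?g"]) simp
  qed
  moreover have "lambda1 G = lambda1 (B n)" if isoG: "digraph_iso (with_proj G) (with_proj (B n))"
  proof -
    obtain f where "bij_betw f (pverts G) (pverts (B n))"
      "\<And>u v. u \<in> pverts G \<Longrightarrow> v \<in> pverts G \<Longrightarrow> (u, v) \<in> parcs G \<longleftrightarrow> (f u, f v) \<in> parcs (B n)"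
      using isoG unfolding digraph_iso_with_proj_iff[OF pair_wf_digraph_axioms wfB] by blast
    thus ?thesis by (intro lambda1_eq_if_isomorphic[OF fin ne symG _ symB]) (simp_all add: pvB)
  qed
  ultimately show ?thesis using main by blast
qed

end
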